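(* Let $f\in L^2_{\rm loc}([0,\infty);L^2(\Omega)^3)$ be time-periodic with period $1$, i.e. $f(t+1,\cdot)=f(t,\cdot)$ for a.e. $t\ge0$. Fix $\delta=(h,\tau)$ with $h>0$ and $\tau=1/T_1$, $T_1\in\mathbb N$. Set $$R_0(\Omega,f):=\frac{1}{1-e^{-A^{-2}}}\Big(\frac{1-e^{-2A^{-2}}}{2A^{-2}}\Big)^{1/2}\|f\|_{L^2([0,1];L^2(\Omega)^3)},$$ $\tilde U_R:=\{\tilde u:\Omega_h\to\mathbb R^3\mid\|\tilde u\|_{\Omega_h}\le R,\ \tilde u|_{\partial\Omega_h}=0\}$, and let $\Phi_\delta:\tilde u^0\mapsto\tilde u^{T_1}$ be the time-$1$ map of the discrete Navier-Stokes equations (see context). Then for any $R\ge R_0(\Omega,f)$ the map $\Phi_\delta:\tilde U_R\to\tilde U_R$ possesses at least one fixed point, which yields a time-periodic solution of the discrete Navier-Stokes equations, i.e. a solution $\bar u^n,\tilde{\bar u}^n$ with $\bar u^{n+T_1}=\bar u^n$ and $\tilde{\bar u}^{n+T_1}=\tilde{\bar u}^n$ for all $n\ge0$.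
   Context: $\Omega\subset\mathbb R^3$ is a bounded connected open set with Lipschitz boundary; $e^1,e^2,e^3$ is the standard basis of $\mathbb R^3$. Grid: for $h>0$ and $B\subset h\mathbb Z^3$, $\partial B:=\{x\in B\mid \{x\pm he^i\}_{i=1,2,3}\not\subset B\}$. $C_r(x):=\prod_{i=1}^3[x_i-\frac r2,x_i+\frac r2]$ and $\Omega_h:=\{x\in\Omega\cap h\mathbb Z^3\mid C_{4h}(x)\subset\Omega\}$. Functions on $\Omega_h$ are extended by $0$ outside $\Omega_h$, and $D_i^+\phi(x)=\frac{\phi(x+he^i)-\phi(x)}{h}$, $D_i\phi(x)=\frac{\phi(x+he^i)-\phi(x-he^i)}{2h}$, $D_i^2\phi(x)=\frac{\phi(x+he^i)+\phi(x-he^i)-2\phi(x)}{h^2}$, $\mathcal D\phi=(D_1\phi,D_2\phi,D_3\phi)$, $\mathcal D\cdot w=\sum_iD_iw_i$. Norm: $\|u\|_{\Omega_h}=(\sum_{x\in\Omega_h}|u(x)|^2h^3)^{1/2}$. $h\mathbb Z^3$ is partitioned into the eight parity classes $G^1,\dots,G^8$ (points $hz$ according to the parities of $z_1,z_2,z_3$). $\Omega_h^\circ:=\{x\in\Omega_h\setminus\partial\Omega_h\mid x+\sum_ia^ihe^i\in\Omega_h\setminus\partial\Omega_h \text{ for all } a^1,a^2,a^3\in\{0,1,2\}\}$, $\Omega_h^{\circ j}:=\Omega_h^\circ\cap G^j$. Standing assumption: $h$ is small enough that each $\Omega_h^{\circ j}$ is connected (via steps in $\{\pm2he^i\}$). Discrete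 Helmholtz-Hodge decomposition: for each $u:\Omega_h\to\mathbb R^3$ there are $w:\Omega_h\to\mathbb R^3$, $\phi:\Omega_h\to\mathbb R$ with $\mathcal D\cdot w=0$ on $\Omega_h$, $w+\mathcal D\phi=u$ on $\Omega_h\setminus\partial\Omega_h$, $w=0$ on $\partial\Omega_h$, $\sum_{x\in\Omega_h^{\circ j}}\phi(x)=0$ ($j=1,\dots,8$); $w$ is uniquely determined and $P_hu:=w$. Discrete Navier-Stokes equations: with $f^n(x):=\tau^{-1}h^{-3}\int_{\tau n}^{\tau(n+1)}\int_{C_h(x)}f(t,y)\,dy\,dt$ and given $\tilde u^0:\Omega_h\to\mathbb R^3$, put $u^0=P_h\tilde u^0$ and for $n\ge0$ $$\frac{\tilde u^{n+1}(x)-u^n(x)}{\tau}=-\frac12\sum_{j=1}^3\Big(u^n_j(x-he^j)D_j\tilde u^{n+1}(x-he^j)+u^n_j(x+he^j)D_j\tilde u^{n+1}(x+he^j)\Big)+\sum_{j=1}^3D_j^2\tilde u^{n+1}(x)+f^n(x)$$ for $x\in\Omega_h\setminus\partial\Omega_h$, $\tilde u^{n+1}=0$ on $\partial\Omega_h$, $u^{n+1}=P_h\tilde u^{n+1}$. (These are uniquely solvable for all $n$, and $\Phi_\delta$ maps $\tilde U_R$ into itself for $R\ge R_0(\Omega,f)$.) $A>0$ is a constant depending only on the diameter of $\Omega$ such that $\sum_{x\in\Omega_h}|\phi(x)|^2\le A^2\sum_{x\in\Omega_h\setminus\partial\Omega_h}|D_i^+\phi(x)|^2$ for $i=1,2,3$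 and every $\phi:\Omega_h\to\mathbb R$ with $\phi|_{\partial\Omega_h}=0$. *)

theory Defs
  imports "HOL-Analysis.Analysis"
begin

text \<open>
  Throughout, a grid function on \<open>\<Omega>\<^sub>h\<close> is represented by its extension by zero, i.e. by a function
  on all of \<^typ>\<open>real^3\<close> that vanishes outside \<open>\<Omega>\<^sub>h\<close>.
\<close>

section \<open>Domains\<close>

text \<open>
  Near each boundary point, in suitable orthonormal coordinates, the set is the region strictly
  above the graph of a Lipschitz function of the first two coordinates. No translation is needed
  in the change of coordinates since it can be absorbed into \<open>g\<close>.
\<close>

definition lipschitz_boundary :: "(real^3) set \<Rightarrow> bool" where
  "lipschitz_boundary \<Omega> \<longleftrightarrow>
     (\<forall>p\<in>frontier \<Omega>. \<exists>r>0. \<exists>T :: real^3 \<Rightarrow> real^3. \<exists>g :: real \<times> real \<Rightarrow> real. \<exists>L.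
        orthogonal_transformation T \<and> L-lipschitz_on UNIV g \<and>
        (\<forall>x\<in>ball p r. x \<in> \<Omega> \<longleftrightarrow> g (T x $ 1, T x $ 2) < T x $ 3))"

definition lipschitz_domain :: "(real^3) set \<Rightarrow> bool" where
  "lipschitz_domain \<Omega> \<longleftrightarrow> bounded \<Omega> \<and> connected \<Omega> \<and> open \<Omega> \<and> lipschitz_boundary \<Omega>"

section \<open>Grids\<close>

abbreviation e :: "3 \<Rightarrow> real^3" where
  "e i \<equiv> axis i 1"

definition grid :: "real \<Rightarrow> (real^3) set" where
  "grid h = {x. \<exists>z :: int^3. x = (\<chi> i. h * of_int (z $ i))}"

text \<open>The eight parity classes, indexed by which coordinates of \<open>z\<close> are even.\<close>

definition parity_class :: "real \<Rightarrow> bool^3 \<Rightarrow> (real^3) set" where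
  "parity_class h p =
     {x. \<exists>z :: int^3. x = (\<chi> i. h * of_int (z $ i)) \<and> (\<forall>i. even (z $ i) \<longleftrightarrow> p $ i)}"

definition grid_boundary :: "real \<Rightarrow> (real^3) set \<Rightarrow> (real^3) set" where
  "grid_boundary h B = {x\<in>B. \<not> (\<Union>i. {x + h *\<^sub>R e i, x - h *\<^sub>R e i}) \<subseteq> B}"

definition cube :: "real \<Rightarrow> real^3 \<Rightarrow> (real^3) set" where
  "cube r x = cbox (\<chi> i. x $ i - r / 2) (\<chi> i. x $ i + r / 2)"

definition disc :: "(real^3) set \<Rightarrow> real \<Rightarrow> (real^3) set" where
  "disc \<Omega> h = {x \<in> \<Omega> \<inter> grid h. cube (4 * h) x \<subseteq> \<Omega>}"

definition bdry :: "(real^3) set \<Rightarrow> real \<Rightarrow> (real^3) set" where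
  "bdry \<Omega> h = grid_boundary h (disc \<Omega> h)"

definition inner_pts :: "(real^3) set \<Rightarrow> real \<Rightarrow> (real^3) set" where
  "inner_pts \<Omega> h = disc \<Omega> h - bdry \<Omega> h"

text \<open>The sets \<open>\<Omega>\<^sub>h\<^sup>\<circ>\<close> and \<open>\<Omega>\<^sub>h\<^sup>\<circ> \<inter> G\<^sup>j\<close>.\<close>

definition core :: "(real^3) set \<Rightarrow> real \<Rightarrow> (real^3) set" where
  "core \<Omega> h = {x \<in> inner_pts \<Omega> h.
     \<forall>a :: 3 \<Rightarrow> nat. (\<forall>i. a i \<in> {0, 1, 2}) \<longrightarrow>
       x + (\<Sum>i\<in>UNIV. (real (a i) * h) *\<^sub>R e i) \<in> inner_pts \<Omega> h}"

definition core_class :: "(real^3) set \<Rightarrow> real \<Rightarrow> bool^3 \<Rightarrow> (real^3) set" where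
  "core_class \<Omega> h p = core \<Omega> h \<inter> parity_class h p"

definition step_connected :: "real \<Rightarrow> (real^3) set \<Rightarrow> bool" where
  "step_connected h S \<longleftrightarrow>
     (\<forall>x\<in>S. \<forall>y\<in>S.
        (x, y) \<in> {(a, b). a \<in> S \<and> b \<in> S \<and>
                   (\<exists>i. b = a + (2 * h) *\<^sub>R e i \<or> b = a - (2 * h) *\<^sub>R e i)}\<^sup>*)"

text \<open>The standing assumption on the mesh size.\<close>

definition admissible_mesh :: "(real^3) set \<Rightarrow> real \<Rightarrow> bool" where
  "admissible_mesh \<Omega> h \<longleftrightarrow> h > 0 \<and> (\<forall>p. step_connected h (core_class \<Omega> h p))"

section \<open>Grid functions and difference operators\<close>

definition gridfun :: "(real^3) set \<Rightarrow> real \<Rightarrow> (real^3 \<Rightarrow> 'b::real_vector) set" where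
  "gridfun \<Omega> h = {u. \<forall>x. x \<notin> disc \<Omega> h \<longrightarrow> u x = 0}"

definition Dplus :: "real \<Rightarrow> 3 \<Rightarrow> (real^3 \<Rightarrow> 'b::real_vector) \<Rightarrow> real^3 \<Rightarrow> 'b" where
  "Dplus h i \<phi> x = (\<phi> (x + h *\<^sub>R e i) - \<phi> x) /\<^sub>R h"

definition Dc :: "real \<Rightarrow> 3 \<Rightarrow> (real^3 \<Rightarrow> 'b::real_vector) \<Rightarrow> real^3 \<Rightarrow> 'b" where
  "Dc h i \<phi> x = (\<phi> (x + h *\<^sub>R e i) - \<phi> (x - h *\<^sub>R e i)) /\<^sub>R (2 * h)"

definition Dsq :: "real \<Rightarrow> 3 \<Rightarrow> (real^3 \<Rightarrow> 'b::real_vector) \<Rightarrow> real^3 \<Rightarrow> 'b" where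
  "Dsq h i \<phi> x = (\<phi> (x + h *\<^sub>R e i) + \<phi> (x - h *\<^sub>R e i) - 2 *\<^sub>R \<phi> x) /\<^sub>R h^2"

definition dgrad :: "real \<Rightarrow> (real^3 \<Rightarrow> real) \<Rightarrow> real^3 \<Rightarrow> real^3" where
  "dgrad h \<phi> x = (\<chi> i. Dc h i \<phi> x)"

definition ddiv :: "real \<Rightarrow> (real^3 \<Rightarrow> real^3) \<Rightarrow> real^3 \<Rightarrow> real" where
  "ddiv h w x = (\<Sum>i\<in>UNIV. Dc h i (\<lambda>y. w y $ i) x)"

definition gnorm :: "(real^3) set \<Rightarrow> real \<Rightarrow> (real^3 \<Rightarrow> real^3) \<Rightarrow> real" where
  "gnorm \<Omega> h u = sqrt (\<Sum>x\<in>disc \<Omega> h. (norm (u x))^2 * h^3)"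

text \<open>
  \<open>A\<close> is a function of the diameter, which expresses that the constant depends on nothing else.
\<close>

definition poincare_constant :: "(real \<Rightarrow> real) \<Rightarrow> bool" where
  "poincare_constant A \<longleftrightarrow>
     (\<forall>d>0. A d > 0) \<and>
     (\<forall>\<Omega> h. lipschitz_domain \<Omega> \<longrightarrow> admissible_mesh \<Omega> h \<longrightarrow>
        (\<forall>i. \<forall>\<phi> :: real^3 \<Rightarrow> real. \<phi> \<in> gridfun \<Omega> h \<longrightarrow> (\<forall>x\<in>bdry \<Omega> h. \<phi> x = 0) \<longrightarrow>
           (\<Sum>x\<in>disc \<Omega> h. \<bar>\<phi> x\<bar>^2)
             \<le> (A (diameter \<Omega>))^2 * (\<Sum>x\<in>inner_pts \<Omega> h. \<bar>Dplus h i \<phi> x\<bar>^2)))"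

section \<open>Discrete Helmholtz--Hodge decomposition\<close>

definition helmholtz_decomp ::
  "(real^3) set \<Rightarrow> real \<Rightarrow> (real^3 \<Rightarrow> real^3) \<Rightarrow> (real^3 \<Rightarrow> real^3) \<Rightarrow> (real^3 \<Rightarrow> real) \<Rightarrow> bool" where
  "helmholtz_decomp \<Omega> h u w \<phi> \<longleftrightarrow>
     w \<in> gridfun \<Omega> h \<and> \<phi> \<in> gridfun \<Omega> h \<and>
     (\<forall>x\<in>disc \<Omega> h. ddiv h w x = 0) \<and>
     (\<forall>x\<in>inner_pts \<Omega> h. w x + dgrad h \<phi> x = u x) \<and>
     (\<forall>x\<in>bdry \<Omega> h. w x = 0) \<and>
     (\<forall>p. (\<Sum>x\<in>core_class \<Omega> h p. \<phi> x) = 0)"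

definition helmholtz_proj ::
  "(real^3) set \<Rightarrow> real \<Rightarrow> (real^3 \<Rightarrow> real^3) \<Rightarrow> (real^3 \<Rightarrow> real^3)" where
  "helmholtz_proj \<Omega> h u = (THE w. \<exists>\<phi>. helmholtz_decomp \<Omega> h u w \<phi>)"

section \<open>External force\<close>

text \<open>
  The class \<open>L\<^sup>2\<^sub>l\<^sub>o\<^sub>c([0,\<infinity>); L\<^sup>2(\<Omega>)\<^sup>3)\<close>, in terms of jointly Borel measurable representatives
  (every class has one).
\<close>

definition L2loc :: "(real^3) set \<Rightarrow> (real \<Rightarrow> real^3 \<Rightarrow> real^3) \<Rightarrow> bool" where
  "L2loc \<Omega> f \<longleftrightarrow>
     set_borel_measurable lborel ({0..} \<times> \<Omega>) (\<lambda>(t, x). f t x) \<and>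
     (\<forall>T\<ge>0. set_integrable lborel ({0..T} \<times> \<Omega>) (\<lambda>(t, x). (norm (f t x))^2))"

definition L2norm01 :: "(real^3) set \<Rightarrow> (real \<Rightarrow> real^3 \<Rightarrow> real^3) \<Rightarrow> real" where
  "L2norm01 \<Omega> f =
     sqrt (LINT t:{0..1}|lborel. (LINT x:\<Omega>|lborel. (norm (f t x))^2))"

definition time_periodic1 :: "(real^3) set \<Rightarrow> (real \<Rightarrow> real^3 \<Rightarrow> real^3) \<Rightarrow> bool" where
  "time_periodic1 \<Omega> f \<longleftrightarrow>
     (AE t in lborel. t \<ge> 0 \<longrightarrow> (AE x in lborel. x \<in> \<Omega> \<longrightarrow> f (t + 1) x = f t x))"

definition force :: "real \<Rightarrow> real \<Rightarrow> (real \<Rightarrow> real^3 \<Rightarrow> real^3) \<Rightarrow> nat \<Rightarrow> real^3 \<Rightarrow> real^3" where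
  "force h \<tau> f n x =
     (LINT t:{\<tau> * real n..\<tau> * (real n + 1)}|lborel. (LINT y:cube h x|lborel. f t y)) /\<^sub>R (\<tau> * h^3)"

section \<open>Discrete Navier--Stokes equations\<close>

definition ns_step ::
  "(real^3) set \<Rightarrow> real \<Rightarrow> real \<Rightarrow> (real^3 \<Rightarrow> real^3) \<Rightarrow> (real^3 \<Rightarrow> real^3) \<Rightarrow> (real^3 \<Rightarrow> real^3) \<Rightarrow> bool" where
  "ns_step \<Omega> h \<tau> F u v \<longleftrightarrow>
     (\<forall>x\<in>inner_pts \<Omega> h.
        (v x - u x) /\<^sub>R \<tau> =
          - (1/2) *\<^sub>R (\<Sum>j\<in>UNIV.
               (u (x - h *\<^sub>R e j) $ j) *\<^sub>R Dc h j v (x - h *\<^sub>R e j) +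
               (u (x + h *\<^sub>R e j) $ j) *\<^sub>R Dc h j v (x + h *\<^sub>R e j))
          + (\<Sum>j\<in>UNIV. Dsq h j v x) + F x) \<and>
     (\<forall>x\<in>bdry \<Omega> h. v x = 0)"

text \<open>In \<open>ns_solution \<Omega> h \<tau> f u ut\<close>, the sequence \<open>ut\<close> is the one written with a tilde.\<close>

definition ns_solution ::
  "(real^3) set \<Rightarrow> real \<Rightarrow> real \<Rightarrow> (real \<Rightarrow> real^3 \<Rightarrow> real^3) \<Rightarrow>
   (nat \<Rightarrow> real^3 \<Rightarrow> real^3) \<Rightarrow> (nat \<Rightarrow> real^3 \<Rightarrow> real^3) \<Rightarrow> bool" where
  "ns_solution \<Omega> h \<tau> f u ut \<longleftrightarrow>
     (\<forall>n. ut n \<in> gridfun \<Omega> h \<and> u n = helmholtz_proj \<Omega> h (ut n)) \<and>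
     (\<forall>n. ns_step \<Omega> h \<tau> (force h \<tau> f n) (u n) (ut (Suc n)))"

definition time_one_map ::
  "(real^3) set \<Rightarrow> real \<Rightarrow> nat \<Rightarrow> (real \<Rightarrow> real^3 \<Rightarrow> real^3) \<Rightarrow> (real^3 \<Rightarrow> real^3) \<Rightarrow> (real^3 \<Rightarrow> real^3)" where
  "time_one_map \<Omega> h T1 f v0 =
     (THE v. \<exists>u ut. ns_solution \<Omega> h (1 / real T1) f u ut \<and> ut 0 = v0 \<and> ut T1 = v)"

definition U_ball :: "(real^3) set \<Rightarrow> real \<Rightarrow> real \<Rightarrow> (real^3 \<Rightarrow> real^3) set" where
  "U_ball \<Omega> h R = {v \<in> gridfun \<Omega> h. gnorm \<Omega> h v \<le> R \<and> (\<forall>x\<in>bdry \<Omega> h. v x = 0)}"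

definition R0 :: "(real \<Rightarrow> real) \<Rightarrow> (real^3) set \<Rightarrow> (real \<Rightarrow> real^3 \<Rightarrow> real^3) \<Rightarrow> real" where
  "R0 A \<Omega> f =
     (let a = 1 / (A (diameter \<Omega>))^2 in
      1 / (1 - exp (- a)) * sqrt ((1 - exp (- 2 * a)) / (2 * a)) * L2norm01 \<Omega> f)"

end

theory Submission
  imports Defs
begin

text \<open>
  Testing one time step with its own solution kills the convection term, since the advecting field
  is discretely solenoidal, and the Poincare inequality in each of the three directions turns the
  diffusion into exponential decay. With Young's inequality and \<open>b = 3 / A\<^sup>2\<close> this gives
  \<open>\<parallel>u\<^sup>T\<parallel>\<^sup>2 \<le> \<parallel>u\<^sup>0\<parallel>\<^sup>2 / (1 + b) + \<parallel>f\<parallel>\<^sup>2 / b\<close> over one period, so every ball of radius at least \<open>R\<^sub>0\<close> is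
  mapped into itself. The same energy identity makes each implicit step uniquely solvable and
  continuous, and Brouwer's theorem, obtained from Kuhn's combinatorial lemma in a dimension that
  is not a type, yields the fixed point. Both the Helmholtz decomposition and the linear solve
  come from one orthogonal projection onto the span of finitely many grid functions.
\<close>

text \<open>Implicit stepping weakens exponential decay: over one period the energy is divided by
  \<open>(1 + b * \<tau>) ^ T\<close>, which lies between 1 + b and exp b. \<open>R0\<close> is
  written with exponentials and does not depend on \<tau>, so the comparison is made with the worst
  case 1 + b. With the rate a = 1 / A^2 of a single direction this would fail for small a; the room
  comes from b = 3 * a. The fixed point is sought in the tilde variable. The advecting field of a
  step is then always a projection, hence solenoidal and zero on the boundary for every initial
  field in the ball, and the projection costs nothing because it is a contraction. As the advecting
  field is taken from the previous time level, each step is linear in its unknown. Centred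
  differences link only points of equal parity, so a discrete gradient cannot see eight independent
  constants; this is why the potential is normalised class by class.\<close>

section \<open>Brouwer's theorem for finitely supported functions\<close>

text \<open>Bolzano-Weierstrass one coordinate at a time: each new index refines the subsequence
  already found, and the coordinates settled earlier keep their limits.\<close>

lemma convergent_subseq_finite:
  fixes X :: "nat \<Rightarrow> 'i \<Rightarrow> real"
  assumes "finite S" and "\<And>m i. i \<in> S \<Longrightarrow> X m i \<in> {0..1}"
  shows "\<exists>l r. strict_mono r \<and> (\<forall>i\<in>S. (\<lambda>m. X (r m) i) \<longlonglongrightarrow> l i)"
  using assms
proof (induction S)
  case empty
  then show ?case by (auto intro: exI[of _ id] simp: strict_mono_id)
next
  case (insert k S)
  then obtain l r where r: "strict_mono r" "\<forall>i\<in>S. (\<lambda>m. X (r m) i) \<longlonglongrightarrow> l i"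
    by (metis insertCI)
  have "\<forall>m. X (r m) k \<in> {0..1}" using insert.prems by simp
  then obtain c s where s: "strict_mono s" "((\<lambda>m. X (r m) k) \<circ> s) \<longlonglongrightarrow> c"
    using compact_Icc[of "0::real" 1] unfolding compact_def by metis
  have "(\<lambda>m. X ((r \<circ> s) m) i) \<longlonglongrightarrow> (l(k := c)) i" if "i \<in> insert k S" for i
  proof (cases "i = k")
    case True
    then show ?thesis using s(2) by (simp add: o_def)
  next
    case False
    then have "((\<lambda>m. X (r m) i) \<circ> s) \<longlonglongrightarrow> l i"
      using that r(2) s(1) by (intro LIMSEQ_subseq_LIMSEQ) auto
    then show ?thesis using False by (simp add: o_def)
  qed
  then show ?case using strict_mono_o[OF r(1) s(1)] by blast
qed

text \<open>
  The type \<^typ>\<open>nat \<Rightarrow> real\<close> with an explicit bound \<open>n\<close> is used since the dimension is the number of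
  grid points, which no type of class \<^class>\<open>euclidean_space\<close> can express.
\<close>

lemma brouwer_unit_cube:
  fixes F :: "(nat \<Rightarrow> real) \<Rightarrow> nat \<Rightarrow> real" and n :: nat
  defines "K \<equiv> {x. \<forall>i<n. 0 \<le> x i \<and> x i \<le> 1}"
  assumes self: "\<And>x. x \<in> K \<Longrightarrow> F x \<in> K"
    and cont: "\<And>X x i. (\<And>m. X m \<in> K) \<Longrightarrow> x \<in> K \<Longrightarrow> (\<And>j. j < n \<Longrightarrow> (\<lambda>m. X m j) \<longlonglongrightarrow> x j) \<Longrightarrow> i < n
      \<Longrightarrow> (\<lambda>m. F (X m) i) \<longlonglongrightarrow> F x i"
  shows "\<exists>x\<in>K. \<forall>i<n. F x i = x i"
proof -
  define pt :: "nat \<Rightarrow> (nat \<Rightarrow> nat) \<Rightarrow> nat \<Rightarrow> real" where "pt p q = (\<lambda>i. real (q i) / real (Suc p))" for p q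
  \<comment> \<open>Label 0 says that \<open>F\<close> does not lower coordinate \<open>i\<close>,
    label 1 that it does not raise it. The values on opposite faces are those demanded by Kuhn's
    lemma; they agree with this meaning because \<open>F\<close> maps into the cube.\<close>
  define label :: "nat \<Rightarrow> (nat \<Rightarrow> nat) \<Rightarrow> nat \<Rightarrow> nat" where
    "label p q i = (if q i = 0 then 0 else if q i = Suc p then 1 else if pt p q i \<le> F (pt p q) i then 0 else 1)" for p q i
  have ptK: "pt p q \<in> K" if "\<forall>i<n. q i \<le> Suc p" for p q
    using that by (auto simp: K_def pt_def divide_le_eq_1)
  have label0: "pt p q i \<le> F (pt p q) i" if "\<forall>i<n. q i \<le> Suc p" "i < n" "label p q i = 0" for p q i
    using that self[OF ptK[OF that(1)]] by (auto simp: label_def K_def pt_def split: if_splits)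
  have label1: "F (pt p q) i \<le> pt p q i" if "\<forall>i<n. q i \<le> Suc p" "i < n" "label p q i = 1" for p q i
    using that self[OF ptK[OF that(1)]] by (auto simp: label_def K_def pt_def split: if_splits)
  define cell :: "(nat \<Rightarrow> nat) \<Rightarrow> (nat \<Rightarrow> nat) \<Rightarrow> bool" where
    "cell q r \<longleftrightarrow> (\<forall>j<n. q j \<le> r j \<and> r j \<le> q j + 1)" for q r
  have "\<exists>q. (\<forall>i<n. q i < Suc p) \<and> (\<forall>i<n. \<exists>r s. cell q r \<and> cell q s \<and> label p r i \<noteq> label p s i)" for p
  proof (rule kuhn_lemma[of "Suc p" n "label p"], goal_cases)
    case (5 q)
    then show ?case unfolding cell_def by (intro exI[of _ q] conjI)
  qed (auto simp: label_def)
  then obtain q where q: "\<And>p i. i < n \<Longrightarrow> q p i < Suc p"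
      and rs: "\<And>p i. i < n \<Longrightarrow> \<exists>r s. cell (q p) r \<and> cell (q p) s \<and> label p r i \<noteq> label p s i"
    by metis
  \<comment> \<open>Kuhn's lemma only says that two labels differ. Swapping the vertices if
    necessary lets \<open>r\<close> carry 0 and \<open>s\<close> carry 1; the pair depends on the
    coordinate \<open>i\<close>.\<close>
  have "\<forall>p i. \<exists>r s. i < n \<longrightarrow> cell (q p) r \<and> cell (q p) s \<and> label p r i = 0 \<and> label p s i = 1"
  proof (intro allI)
    fix p i
    show "\<exists>r s. i < n \<longrightarrow> cell (q p) r \<and> cell (q p) s \<and> label p r i = 0 \<and> label p s i = 1"
    proof (cases "i < n")
      case i: True
      obtain r s where *: "cell (q p) r" "cell (q p) s" "label p r i \<noteq> label p s i" using rs[OF i] by metis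
      have "label p r i = 0 \<and> label p s i = 1 \<or> label p s i = 0 \<and> label p r i = 1"
        using *(3) by (auto simp: label_def split: if_splits)
      then show ?thesis using * by blast
    qed simp
  qed
  then obtain r s where *: "\<forall>p i. i < n \<longrightarrow> cell (q p) (r p i) \<and> cell (q p) (s p i) \<and>
      label p (r p i) i = 0 \<and> label p (s p i) i = 1"
    unfolding choice_iff by blast
  then have l: "\<And>p i. i < n \<Longrightarrow> label p (r p i) i = 0 \<and> label p (s p i) i = 1" by blast
  from * have "\<And>p i. i < n \<Longrightarrow> cell (q p) (r p i)" "\<And>p i. i < n \<Longrightarrow> cell (q p) (s p i)" by blast+
  then have
    r: "\<And>p i j. i < n \<Longrightarrow> j < n \<Longrightarrow> q p j \<le> r p i j \<and> r p i j \<le> q p j + 1" and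
    s: "\<And>p i j. i < n \<Longrightarrow> j < n \<Longrightarrow> q p j \<le> s p i j \<and> s p i j \<le> q p j + 1"
    by (simp_all add: cell_def)
  have rle: "\<forall>j<n. r p i j \<le> Suc p" and sle: "\<forall>j<n. s p i j \<le> Suc p" if "i < n" for p i
    using r[OF that] s[OF that] q by (metis Suc_eq_plus1 Suc_leI le_trans)+
  obtain x \<sigma> where \<sigma>: "strict_mono \<sigma>" and x: "\<forall>i\<in>{..<n}. (\<lambda>m. pt (\<sigma> m) (q (\<sigma> m)) i) \<longlonglongrightarrow> x i"
  proof -
    have "pt p (q p) \<in> K" for p by (intro ptK) (simp add: q less_imp_le)
    then have "\<And>p i. i \<in> {..<n} \<Longrightarrow> pt p (q p) i \<in> {0..1}" by (simp add: K_def)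
    from convergent_subseq_finite[of "{..<n}" "\<lambda>p. pt p (q p)", OF finite_lessThan this] show ?thesis using that by blast
  qed
  \<comment> \<open>Vertices of one cell differ by at most 1 / Suc p in each coordinate, so every
    choice of vertices inherits the limit of the base vertices \<open>q\<close>. The witnesses of
    different coordinates therefore meet in one point.\<close>
  have near: "(\<lambda>m. pt (\<sigma> m) (t (\<sigma> m)) j) \<longlonglongrightarrow> x j" and nearK: "pt (\<sigma> m) (t (\<sigma> m)) \<in> K"
    if t: "\<And>p j. j < n \<Longrightarrow> q p j \<le> t p j \<and> t p j \<le> q p j + 1" and j: "j < n" for t j m
  proof -
    show "pt (\<sigma> m) (t (\<sigma> m)) \<in> K"
      by (intro ptK) (metis Suc_eq_plus1 Suc_leI le_trans q t)
    have "(\<lambda>m. 1 / real (Suc (\<sigma> m))) \<longlonglongrightarrow> 0"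
      using LIMSEQ_subseq_LIMSEQ[OF LIMSEQ_inverse_real_of_nat \<sigma>] by (simp add: o_def inverse_eq_divide)
    moreover have "\<forall>\<^sub>F m in sequentially. norm (pt (\<sigma> m) (t (\<sigma> m)) j - pt (\<sigma> m) (q (\<sigma> m)) j) \<le> 1 / real (Suc (\<sigma> m))"
    proof (intro always_eventually allI)
      fix m
      have "\<bar>real (t (\<sigma> m) j) - real (q (\<sigma> m) j)\<bar> \<le> 1" using t[OF j, of "\<sigma> m"] by linarith
      then show "norm (pt (\<sigma> m) (t (\<sigma> m)) j - pt (\<sigma> m) (q (\<sigma> m)) j) \<le> 1 / real (Suc (\<sigma> m))"
        unfolding pt_def real_norm_def diff_divide_distrib[symmetric] abs_divide
        by (simp add: divide_right_mono)
    qed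
    ultimately have "(\<lambda>m. pt (\<sigma> m) (t (\<sigma> m)) j - pt (\<sigma> m) (q (\<sigma> m)) j) \<longlonglongrightarrow> 0"
      by (rule Lim_null_comparison[rotated])
    from tendsto_add[OF this x[THEN bspec, of j]] show "(\<lambda>m. pt (\<sigma> m) (t (\<sigma> m)) j) \<longlonglongrightarrow> x j"
      using j by simp
  qed
  have xK: "x \<in> K"
    unfolding K_def
  proof (intro CollectI allI impI conjI)
    fix i assume i: "i < n"
    have "pt (\<sigma> m) (q (\<sigma> m)) \<in> K" for m by (intro ptK) (simp add: q less_imp_le)
    then have b: "0 \<le> pt (\<sigma> m) (q (\<sigma> m)) i \<and> pt (\<sigma> m) (q (\<sigma> m)) i \<le> 1" for m
      using i by (simp add: K_def)
    have lim: "(\<lambda>m. pt (\<sigma> m) (q (\<sigma> m)) i) \<longlonglongrightarrow> x i" using x i by simp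
    show "0 \<le> x i" by (rule LIMSEQ_le_const[OF lim]) (use b in blast)
    show "x i \<le> 1" by (rule LIMSEQ_le_const2[OF lim]) (use b in blast)
  qed
  have "F x i = x i" if i: "i < n" for i
  proof (rule antisym)
    have "(\<lambda>m. F (pt (\<sigma> m) (s (\<sigma> m) i)) i) \<longlonglongrightarrow> F x i"
      using s[OF i] by (intro cont nearK[OF _ i] near xK i) auto
    moreover have "(\<lambda>m. pt (\<sigma> m) (s (\<sigma> m) i) i) \<longlonglongrightarrow> x i" using s[OF i] i by (intro near) auto
    moreover have "F (pt (\<sigma> m) (s (\<sigma> m) i)) i \<le> pt (\<sigma> m) (s (\<sigma> m) i) i" for m
      using l[OF i] i by (intro label1 sle) auto
    ultimately show "F x i \<le> x i" by (intro LIMSEQ_le[of _ "F x i" _ "x i"]) auto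
    have "(\<lambda>m. F (pt (\<sigma> m) (r (\<sigma> m) i)) i) \<longlonglongrightarrow> F x i"
      using r[OF i] by (intro cont nearK[OF _ i] near xK i) auto
    moreover have "(\<lambda>m. pt (\<sigma> m) (r (\<sigma> m) i) i) \<longlonglongrightarrow> x i" using r[OF i] i by (intro near) auto
    moreover have "pt (\<sigma> m) (r (\<sigma> m) i) i \<le> F (pt (\<sigma> m) (r (\<sigma> m) i)) i" for m
      using l[OF i] i by (intro label0 rle) auto
    ultimately show "x i \<le> F x i" by (intro LIMSEQ_le[of _ "x i" _ "F x i"]) auto
  qed
  then show ?thesis using xK by blast
qed

section \<open>Normal equations\<close>

text \<open>
  Gram--Schmidt: the new generator is replaced by its component orthogonal to the previous ones,
  which contributes nothing when it vanishes.
\<close>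

lemma normal_equations_solvable:
  fixes g :: "'i \<Rightarrow> 'x \<Rightarrow> 'b::real_inner"
  assumes "finite S" "finite X"
  shows "\<exists>c. \<forall>j\<in>S. (\<Sum>x\<in>X. (b x - (\<Sum>i\<in>S. c i *\<^sub>R g i x)) \<bullet> g j x) = 0"
  using assms(1)
proof (induction S arbitrary: b)
  case empty
  then show ?case by simp
next
  case (insert k S)
  \<comment> \<open>The induction hypothesis is general in the right-hand side, so it also applies
    to the new generator: \<open>d\<close> holds the coefficients of its projection onto the old
    span.\<close>
  obtain d where d: "\<forall>j\<in>S. (\<Sum>x\<in>X. (g k x - (\<Sum>i\<in>S. d i *\<^sub>R g i x)) \<bullet> g j x) = 0"
    using insert.IH by blast
  obtain c where c: "\<forall>j\<in>S. (\<Sum>x\<in>X. (b x - (\<Sum>i\<in>S. c i *\<^sub>R g i x)) \<bullet> g j x) = 0"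
    using insert.IH by blast
  define p where "p x = g k x - (\<Sum>i\<in>S. d i *\<^sub>R g i x)" for x
  define q where "q x = b x - (\<Sum>i\<in>S. c i *\<^sub>R g i x)" for x
  define N where "N = (\<Sum>x\<in>X. p x \<bullet> p x)"
  \<comment> \<open>For \<open>N\<close> = 0 the quotient is 0 by convention, and \<open>p\<close>
    vanishes on \<open>X\<close>, so the relation
    \<open>(\<Sum>x\<in>X. q x \<bullet> p x) = t * N\<close> survives.\<close>
  define t where "t = (\<Sum>x\<in>X. q x \<bullet> p x) / N"
  define c' where "c' i = (if i = k then t else c i - t * d i)" for i
  have pS: "(\<Sum>x\<in>X. p x \<bullet> g j x) = 0" and qS: "(\<Sum>x\<in>X. q x \<bullet> g j x) = 0" if "j \<in> S" for j
    using c d that by (auto simp: p_def q_def)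
  have res: "b x - (\<Sum>i\<in>insert k S. c' i *\<^sub>R g i x) = q x - t *\<^sub>R p x" for x
  proof -
    have "(\<Sum>i\<in>S. c' i *\<^sub>R g i x) = (\<Sum>i\<in>S. c i *\<^sub>R g i x) - t *\<^sub>R (\<Sum>i\<in>S. d i *\<^sub>R g i x)"
      unfolding scaleR_sum_right sum_subtractf[symmetric] using insert.hyps
      by (intro sum.cong) (auto simp: c'_def algebra_simps)
    then show ?thesis using insert.hyps by (simp add: c'_def p_def q_def algebra_simps)
  qed
  have "(\<Sum>x\<in>X. q x \<bullet> p x) = t * N"
  proof (cases "N = 0")
    case True
    then have "\<forall>x\<in>X. p x = 0" using assms(2) by (simp add: N_def sum_nonneg_eq_0_iff)
    then show ?thesis using True by simp
  qed (simp add: t_def)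
  then have orth_p: "(\<Sum>x\<in>X. (q x - t *\<^sub>R p x) \<bullet> p x) = 0"
    by (simp add: inner_diff_left sum_subtractf N_def sum_distrib_left)
  have orth_S: "(\<Sum>x\<in>X. (q x - t *\<^sub>R p x) \<bullet> g j x) = 0" if "j \<in> S" for j
    using pS[OF that] qS[OF that] by (simp add: inner_diff_left sum_subtractf flip: sum_distrib_left)
  \<comment> \<open>\<open>g k\<close> is \<open>p\<close> plus a combination of old generators, and
    the residual is orthogonal to both parts.\<close>
  have "(\<Sum>x\<in>X. (q x - t *\<^sub>R p x) \<bullet> g k x)
      = (\<Sum>x\<in>X. (q x - t *\<^sub>R p x) \<bullet> p x) + (\<Sum>i\<in>S. d i * (\<Sum>x\<in>X. (q x - t *\<^sub>R p x) \<bullet> g i x))"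
  proof -
    have "(q x - t *\<^sub>R p x) \<bullet> g k x
        = (q x - t *\<^sub>R p x) \<bullet> p x + (\<Sum>i\<in>S. d i * ((q x - t *\<^sub>R p x) \<bullet> g i x))" for x
      unfolding inner_scaleR_right[symmetric] inner_sum_right[symmetric] inner_add_right[symmetric]
      by (simp add: p_def)
    moreover have "(\<Sum>i\<in>S. d i * (\<Sum>x\<in>X. (q x - t *\<^sub>R p x) \<bullet> g i x))
        = (\<Sum>x\<in>X. \<Sum>i\<in>S. d i * ((q x - t *\<^sub>R p x) \<bullet> g i x))"
      unfolding sum_distrib_left by (rule sum.swap)
    ultimately show ?thesis by (simp add: sum.distrib)
  qed
  then have "(\<Sum>x\<in>X. (q x - t *\<^sub>R p x) \<bullet> g k x) = 0" by (simp add: orth_p orth_S)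
  then show ?case using orth_S unfolding res[symmetric] by (intro exI[of _ c']) blast
qed

section \<open>Brouwer's theorem on balls of finitely supported functions\<close>

text \<open>
  Precomposing with the radial retraction extends the map from the ball to a cube containing it.
\<close>

lemma brouwer_ball_finite_support:
  fixes F :: "('x \<Rightarrow> 'b::euclidean_space) \<Rightarrow> 'x \<Rightarrow> 'b" and X :: "'x set" and r :: real
  defines "K \<equiv> {u. (\<forall>x. x \<notin> X \<longrightarrow> u x = 0) \<and> (\<Sum>x\<in>X. (norm (u x))\<^sup>2) \<le> r\<^sup>2}"
  assumes X: "finite X" and r: "0 \<le> r"
    and self: "\<And>u. u \<in> K \<Longrightarrow> F u \<in> K"
    and cont: "\<And>U u x. (\<And>m. U m \<in> K) \<Longrightarrow> u \<in> K \<Longrightarrow> (\<And>y. (\<lambda>m. U m y) \<longlonglongrightarrow> u y)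
      \<Longrightarrow> (\<lambda>m. F (U m) x) \<longlonglongrightarrow> F u x"
  shows "\<exists>u\<in>K. F u = u"
\<comment> \<open>The cube coordinates below divide by \<open>r\<close>; the ball of radius 0
  contains the zero function alone.\<close>
proof (cases "r = 0")
  case True
  have "u x = 0" if "u \<in> K" for u x
  proof -
    have "(\<Sum>x\<in>X. (norm (u x))\<^sup>2) = 0"
      using that True by (intro antisym sum_nonneg) (auto simp: K_def)
    then show ?thesis using that X by (cases "x \<in> X") (auto simp: K_def sum_nonneg_eq_0_iff)
  qed
  moreover have "(\<lambda>x. 0) \<in> K" by (simp add: K_def)
  ultimately show ?thesis using self by (metis (no_types) ext)
next
  case False
  with r have r: "r > 0" by simp
  define n where "n = card (X \<times> (Basis :: 'b set))"
  have "finite (X \<times> (Basis :: 'b set))" using X by simp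
  then obtain b where b: "bij_betw b (X \<times> (Basis :: 'b set)) {..<n}"
    using ex_bij_betw_finite_nat unfolding n_def atLeast0LessThan by blast
  define g where "g = inv_into (X \<times> (Basis :: 'b set)) b"
  have gb: "g (b (x, k)) = (x, k)" if "x \<in> X" "k \<in> Basis" for x k
    using b that by (simp add: g_def bij_betw_inv_into_left)
  have g: "fst (g i) \<in> X" "snd (g i) \<in> Basis" "b (fst (g i), snd (g i)) = i" if "i < n" for i
    using bij_betw_apply[OF bij_betw_inv_into[OF b], of i] bij_betw_inv_into_right[OF b, of i] that
    by (auto simp: g_def mem_Times_iff)
  have bn: "b (x, k) < n" if "x \<in> X" "k \<in> Basis" for x k
    using bij_betw_apply[OF b, of "(x, k)"] that by simp
  define N where "N u = sqrt (\<Sum>x\<in>X. (norm (u x))\<^sup>2)" for u :: "'x \<Rightarrow> 'b"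
  \<comment> \<open>\<open>vec\<close> carries the unit cube affinely onto the functions on
    \<open>X\<close> with all coordinates in [-r, r], and \<open>coords\<close> is the inverse
    rescaling.\<close>
  define vec where "vec c x = (if x \<in> X then \<Sum>k\<in>Basis. (r * (2 * c (b (x, k)) - 1)) *\<^sub>R k else 0)" for c x
  define \<rho> where "\<rho> u x = (r / max r (N u)) *\<^sub>R u x" for u :: "'x \<Rightarrow> 'b" and x
  define coords where "coords u i = ((u (fst (g i)) \<bullet> snd (g i)) / r + 1) / 2" for u :: "'x \<Rightarrow> 'b" and i
  define G where "G c = coords (F (\<rho> (vec c)))" for c
  have K_iff: "u \<in> K \<longleftrightarrow> (\<forall>x. x \<notin> X \<longrightarrow> u x = 0) \<and> N u \<le> r" for u
    using r by (auto simp: K_def N_def real_le_lsqrt sum_nonneg dest: sqrt_le_D)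
  have N0: "0 \<le> N u" for u by (simp add: N_def sum_nonneg)
  have \<rho>K: "\<rho> (vec c) \<in> K" for c
  proof -
    have "N (\<rho> u) = r / max r (N u) * N u" for u
    proof -
      have "(\<Sum>x\<in>X. (norm (\<rho> u x))\<^sup>2) = (r / max r (N u))\<^sup>2 * (\<Sum>x\<in>X. (norm (u x))\<^sup>2)"
        by (simp add: \<rho>_def power_mult_distrib power_divide sum_distrib_left)
      then show ?thesis using r by (simp add: N_def real_sqrt_mult)
    qed
    moreover have "r / max r (N u) * N u \<le> r" for u
      using r N0[of u] by (simp add: divide_le_eq mult_left_mono)
    ultimately show ?thesis by (auto simp: K_iff \<rho>_def vec_def)
  qed
  have coord_le: "\<bar>u x \<bullet> k\<bar> \<le> r" if "u \<in> K" "x \<in> X" "k \<in> Basis" for u x k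
  proof -
    have "\<bar>u x \<bullet> k\<bar> \<le> norm (u x)" using that by (intro Basis_le_norm)
    also have "norm (u x) \<le> N u"
      unfolding N_def using X that by (intro real_le_rsqrt member_le_sum) auto
    finally show ?thesis using that(1) by (auto simp: K_iff)
  qed
  have "\<exists>c\<in>{c. \<forall>i<n. 0 \<le> c i \<and> c i \<le> 1}. \<forall>i<n. G c i = c i"
  proof (rule brouwer_unit_cube)
    fix c
    have "\<bar>F (\<rho> (vec c)) (fst (g i)) \<bullet> snd (g i)\<bar> \<le> r" if "i < n" for i
      using that by (intro coord_le self \<rho>K g)
    moreover have "0 \<le> (y / r + 1) / 2 \<and> (y / r + 1) / 2 \<le> 1" if "\<bar>y\<bar> \<le> r" for y
      using that r by (auto simp: abs_le_iff field_simps)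
    ultimately show "G c \<in> {c. \<forall>i<n. 0 \<le> c i \<and> c i \<le> 1}"
      by (simp add: G_def coords_def)
  next
    fix C :: "nat \<Rightarrow> nat \<Rightarrow> real" and c i
    assume C: "\<And>j. j < n \<Longrightarrow> (\<lambda>m. C m j) \<longlonglongrightarrow> c j" and i: "i < n"
    have v: "(\<lambda>m. vec (C m) x) \<longlonglongrightarrow> vec c x" for x
      by (cases "x \<in> X") (auto simp: vec_def intro!: tendsto_intros C bn)
    have "(\<lambda>m. N (vec (C m))) \<longlonglongrightarrow> N (vec c)"
      unfolding N_def by (intro tendsto_intros v)
    then have "(\<lambda>m. \<rho> (vec (C m)) x) \<longlonglongrightarrow> \<rho> (vec c) x" for x
      unfolding \<rho>_def using r by (intro tendsto_intros v) auto
    then have "(\<lambda>m. F (\<rho> (vec (C m))) x) \<longlonglongrightarrow> F (\<rho> (vec c)) x" for x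
      by (intro cont \<rho>K)
    then show "(\<lambda>m. G (C m) i) \<longlonglongrightarrow> G c i"
      unfolding G_def coords_def using r by (intro tendsto_intros) auto
  qed
  then obtain c where c: "\<And>i. i < n \<Longrightarrow> G c i = c i" by blast
  have fix_vec: "vec c = F (\<rho> (vec c))"
  proof
    fix x
    show "vec c x = F (\<rho> (vec c)) x"
    proof (cases "x \<in> X")
      case True
      have "r * (2 * c (b (x, k)) - 1) = F (\<rho> (vec c)) x \<bullet> k" if "k \<in> Basis" for k
        using c[OF bn[OF True that]] r by (simp add: G_def coords_def gb[OF True that] field_simps)
      then have "vec c x = (\<Sum>k\<in>Basis. (F (\<rho> (vec c)) x \<bullet> k) *\<^sub>R k)"
        using True by (simp add: vec_def)
      then show ?thesis by (simp add: euclidean_representation)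
    next
      case False
      then show ?thesis using self[OF \<rho>K, of c] by (simp add: K_iff vec_def)
    qed
  qed
  \<comment> \<open>The point found in the cube is a value of \<open>F\<close> on the ball, hence
    lies in the ball, where the retraction is the identity.\<close>
  then have K: "vec c \<in> K" using self[OF \<rho>K] by metis
  then have "\<rho> (vec c) = vec c" using r by (auto simp: K_iff \<rho>_def max_absorb1)
  with fix_vec K show ?thesis by metis
qed

section \<open>Summation by parts on the grid\<close>

locale mesh =
  fixes \<Omega> :: "(real^3) set" and h :: real
  assumes bounded: "bounded \<Omega>" and h: "h > 0"
begin

abbreviation "\<Omega>h \<equiv> disc \<Omega> h"
abbreviation "inn \<equiv> inner_pts \<Omega> h"
text \<open>Extension by zero and the zero boundary condition in one predicate. It is the class of
  functions whose support stays in \<Omega>h under a shift by one mesh width, so that summation by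
  parts leaves no boundary terms.\<close>

abbreviation supp_inner :: "(real^3 \<Rightarrow> 'b::zero) \<Rightarrow> bool" where
  "supp_inner v \<equiv> (\<forall>x. x \<notin> inn \<longrightarrow> v x = 0)"

lemma finite_disc: "finite \<Omega>h"
proof -
  obtain B where B: "\<And>x. x \<in> \<Omega> \<Longrightarrow> norm x \<le> B" using bounded by (auto simp: bounded_iff)
  define N where "N = \<lceil>B / h\<rceil>"
  have "\<Omega>h \<subseteq> (\<lambda>g. \<chi> i. h * of_int (g i)) ` (PiE UNIV (\<lambda>_::3. {-N..N}))"
  proof
    fix x assume x: "x \<in> \<Omega>h"
    then obtain z :: "int^3" where z: "x = (\<chi> i. h * of_int (z $ i))"
      by (auto simp: disc_def grid_def)
    have "z $ i \<in> {-N..N}" for i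
    proof -
      have "\<bar>h * of_int (z $ i)\<bar> \<le> B"
        using component_le_norm_cart[of x i] B[of x] x by (auto simp: z disc_def)
      then have "\<bar>of_int (z $ i)\<bar> \<le> B / h" using h by (simp add: abs_mult field_simps)
      then have "of_int \<bar>z $ i\<bar> \<le> (of_int N :: real)" unfolding N_def by linarith
      then have "\<bar>z $ i\<bar> \<le> N" by (simp only: of_int_le_iff)
      then show ?thesis by auto
    qed
    then have "($) z \<in> PiE UNIV (\<lambda>_::3. {-N..N})" by auto
    then show "x \<in> (\<lambda>g. \<chi> i. h * of_int (g i)) ` (PiE UNIV (\<lambda>_::3. {-N..N}))" unfolding z by blast
  qed
  then show ?thesis by (rule finite_subset) (auto intro!: finite_imageI finite_PiE)
qed

lemma inner_subset: "inn \<subseteq> \<Omega>h"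
  by (auto simp: inner_pts_def)

lemma finite_inner: "finite inn"
  using finite_disc inner_subset by (rule finite_subset[rotated])

lemma inner_step: "x \<in> inn \<Longrightarrow> x + h *\<^sub>R e i \<in> \<Omega>h" "x \<in> inn \<Longrightarrow> x - h *\<^sub>R e i \<in> \<Omega>h"
  by (auto simp: inner_pts_def bdry_def grid_boundary_def)

lemma supp_inner_iff: "v \<in> gridfun \<Omega> h \<and> (\<forall>x\<in>bdry \<Omega> h. v x = 0) \<longleftrightarrow> supp_inner v"
  by (auto simp: gridfun_def inner_pts_def bdry_def grid_boundary_def)

lemma sum_inner_eq: "(\<Sum>x\<in>inn. f x) = (\<Sum>x\<in>\<Omega>h. f x)" if "supp_inner f"
  using that by (intro sum.mono_neutral_left finite_disc inner_subset) auto

text \<open>Both neighbours of an inner point lie in \<Omega>h, so the translate of \<Omega>h still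
  covers \<open>inn\<close>, and \<open>f\<close> vanishes on the rest.\<close>

lemma shift_plus:
  fixes f :: "real^3 \<Rightarrow> real"
  assumes "supp_inner f"
  shows "(\<Sum>x\<in>\<Omega>h. f (x + h *\<^sub>R e i)) = (\<Sum>x\<in>\<Omega>h. f x)"
proof -
  have "(\<Sum>x\<in>\<Omega>h. f (x + h *\<^sub>R e i)) = (\<Sum>y\<in>(\<lambda>x. x + h *\<^sub>R e i) ` \<Omega>h. f y)"
    by (subst sum.reindex) (auto simp: inj_on_def)
  also have "\<dots> = (\<Sum>x\<in>inn. f x)"
  proof (rule sum.mono_neutral_right)
    show "inn \<subseteq> (\<lambda>x. x + h *\<^sub>R e i) ` \<Omega>h"
    proof
      fix x assume "x \<in> inn"
      then show "x \<in> (\<lambda>x. x + h *\<^sub>R e i) ` \<Omega>h"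
        by (intro image_eqI[of _ _ "x - h *\<^sub>R e i"] inner_step) auto
    qed
  qed (use assms finite_disc in auto)
  finally show ?thesis by (simp add: sum_inner_eq[OF assms])
qed

lemma shift_minus:
  fixes f :: "real^3 \<Rightarrow> real"
  assumes "supp_inner f"
  shows "(\<Sum>x\<in>\<Omega>h. f (x - h *\<^sub>R e i)) = (\<Sum>x\<in>\<Omega>h. f x)"
proof -
  have "(\<Sum>x\<in>\<Omega>h. f (x - h *\<^sub>R e i)) = (\<Sum>y\<in>(\<lambda>x. x - h *\<^sub>R e i) ` \<Omega>h. f y)"
    by (subst sum.reindex) (auto simp: inj_on_def)
  also have "\<dots> = (\<Sum>x\<in>inn. f x)"
  proof (rule sum.mono_neutral_right)
    show "inn \<subseteq> (\<lambda>x. x - h *\<^sub>R e i) ` \<Omega>h"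
    proof
      fix x assume "x \<in> inn"
      then show "x \<in> (\<lambda>x. x - h *\<^sub>R e i) ` \<Omega>h"
        by (intro image_eqI[of _ _ "x + h *\<^sub>R e i"] inner_step) auto
    qed
  qed (use assms finite_disc in auto)
  finally show ?thesis by (simp add: sum_inner_eq[OF assms])
qed

text \<open>Each shifted product retains a factor \<open>a\<close>, so the shift lemmas apply with
  \<open>b\<close> arbitrary. This matters because potentials do not vanish on the boundary.\<close>

lemma Dc_adjoint:
  fixes a b :: "real^3 \<Rightarrow> real"
  assumes "supp_inner a"
  shows "(\<Sum>x\<in>\<Omega>h. a x * Dc h i b x) = - (\<Sum>x\<in>\<Omega>h. Dc h i a x * b x)"
proof -
  have "(\<Sum>x\<in>\<Omega>h. a (x + h *\<^sub>R e i) * b x) = (\<Sum>x\<in>\<Omega>h. a x * b (x - h *\<^sub>R e i))"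
    using shift_plus[of "\<lambda>x. a x * b (x - h *\<^sub>R e i)" i] assms by simp
  moreover have "(\<Sum>x\<in>\<Omega>h. a (x - h *\<^sub>R e i) * b x) = (\<Sum>x\<in>\<Omega>h. a x * b (x + h *\<^sub>R e i))"
    using shift_minus[of "\<lambda>x. a x * b (x + h *\<^sub>R e i)" i] assms by simp
  ultimately have "(\<Sum>x\<in>\<Omega>h. a x * (b (x + h *\<^sub>R e i) - b (x - h *\<^sub>R e i)))
      = - (\<Sum>x\<in>\<Omega>h. (a (x + h *\<^sub>R e i) - a (x - h *\<^sub>R e i)) * b x)"
    by (simp add: algebra_simps sum_subtractf)
  from arg_cong[OF this, of "\<lambda>s. inverse (2 * h) * s"] show ?thesis
    by (simp add: Dc_def sum_distrib_left mult.left_commute mult.assoc)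
qed

text \<open>Source of the orthogonality of gradients and solenoidal fields. The divergence is summed
  over all of \<Omega>h, boundary included, which matches the set where the decomposition requires
  it to vanish.\<close>

lemma grad_div_adjoint:
  assumes "supp_inner w"
  shows "(\<Sum>x\<in>inn. w x \<bullet> dgrad h \<phi> x) = - (\<Sum>x\<in>\<Omega>h. \<phi> x * ddiv h w x)"
proof -
  have "(\<Sum>x\<in>inn. w x \<bullet> dgrad h \<phi> x) = (\<Sum>i\<in>UNIV. \<Sum>x\<in>\<Omega>h. w x $ i * Dc h i \<phi> x)"
    using assms by (subst sum_inner_eq) (simp_all add: inner_vec_def dgrad_def sum.swap[of _ UNIV])
  also have "\<dots> = - (\<Sum>i\<in>UNIV. \<Sum>x\<in>\<Omega>h. \<phi> x * Dc h i (\<lambda>y. w y $ i) x)"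
    using assms by (simp add: Dc_adjoint[of "\<lambda>y. w y $ _"] sum_negf mult.commute)
  also have "\<dots> = - (\<Sum>x\<in>\<Omega>h. \<phi> x * ddiv h w x)"
    by (subst sum.swap) (simp add: ddiv_def sum_distrib_left)
  finally show ?thesis .
qed

end

text \<open>The right-hand side of the scheme without the force, linear in \<open>v\<close> with
  \<open>u\<close> frozen. It is polymorphic in the values of \<open>v\<close> because it acts on
  each component separately, which lets the linear solve be done for scalars.\<close>

definition conv_diff :: "real \<Rightarrow> (real^3 \<Rightarrow> real^3) \<Rightarrow> (real^3 \<Rightarrow> 'b::real_vector) \<Rightarrow> real^3 \<Rightarrow> 'b" where
  "conv_diff h u v x =
     - (1/2) *\<^sub>R (\<Sum>j\<in>UNIV.
         (u (x - h *\<^sub>R e j) $ j) *\<^sub>R Dc h j v (x - h *\<^sub>R e j) +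
         (u (x + h *\<^sub>R e j) $ j) *\<^sub>R Dc h j v (x + h *\<^sub>R e j))
     + (\<Sum>j\<in>UNIV. Dsq h j v x)"

section \<open>Energy identities for diffusion and convection\<close>

context mesh
begin

text \<open>With the flux g x = (v x - v (x - h e)) . v x, the integrand times h^2 is g (x + h e) -
  g x minus the squared forward increment, and the two flux sums cancel by shifting.\<close>

lemma Dsq_energy:
  fixes v :: "real^3 \<Rightarrow> 'b::real_inner"
  assumes "supp_inner v"
  shows "(\<Sum>x\<in>\<Omega>h. Dsq h j v x \<bullet> v x) = - (\<Sum>x\<in>\<Omega>h. (norm (Dplus h j v x))\<^sup>2)"
proof -
  have "(\<Sum>x\<in>\<Omega>h. (v (x + h *\<^sub>R e j) - v x) \<bullet> v (x + h *\<^sub>R e j)) = (\<Sum>x\<in>\<Omega>h. (v x - v (x - h *\<^sub>R e j)) \<bullet> v x)"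
    using shift_plus[of "\<lambda>x. (v x - v (x - h *\<^sub>R e j)) \<bullet> v x" j] assms by simp
  moreover have "(v (x + h *\<^sub>R e j) + v (x - h *\<^sub>R e j) - 2 *\<^sub>R v x) \<bullet> v x
      = (v (x + h *\<^sub>R e j) - v x) \<bullet> v (x + h *\<^sub>R e j) - (v x - v (x - h *\<^sub>R e j)) \<bullet> v x
        - (norm (v (x + h *\<^sub>R e j) - v x))\<^sup>2" for x
    by (simp add: power2_norm_eq_inner inner_diff_left inner_diff_right inner_add_left inner_add_right inner_commute)
  ultimately have "(\<Sum>x\<in>\<Omega>h. (v (x + h *\<^sub>R e j) + v (x - h *\<^sub>R e j) - 2 *\<^sub>R v x) \<bullet> v x)
      = - (\<Sum>x\<in>\<Omega>h. (norm (v (x + h *\<^sub>R e j) - v x))\<^sup>2)"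
    by (simp add: sum_subtractf)
  from arg_cong[OF this, of "\<lambda>s. inverse (h\<^sup>2) * s"] show ?thesis
    by (simp add: Dsq_def Dplus_def sum_distrib_left power_mult_distrib power_inverse)
qed

text \<open>Shifting moves both halves of the averaged convection term to the same node, where the
  factor v (x + h e) + v (x - h e) completes the centred difference of \<open>v\<close> to that of
  |v|^2. The symmetric averaging in the scheme is what makes this product rule exact.\<close>

lemma convection_energy:
  fixes v :: "real^3 \<Rightarrow> 'b::real_inner"
  assumes u: "supp_inner u"
  shows "(\<Sum>x\<in>\<Omega>h. ((u (x - h *\<^sub>R e j) $ j) *\<^sub>R Dc h j v (x - h *\<^sub>R e j) +
         (u (x + h *\<^sub>R e j) $ j) *\<^sub>R Dc h j v (x + h *\<^sub>R e j)) \<bullet> v x)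
       = - (\<Sum>x\<in>\<Omega>h. Dc h j (\<lambda>y. u y $ j) x * (v x \<bullet> v x))"
proof -
  have "(\<Sum>x\<in>\<Omega>h. ((u (x - h *\<^sub>R e j) $ j) *\<^sub>R Dc h j v (x - h *\<^sub>R e j)) \<bullet> v x)
      = (\<Sum>x\<in>\<Omega>h. u x $ j * (Dc h j v x \<bullet> v (x + h *\<^sub>R e j)))"
    using shift_minus[of "\<lambda>x. u x $ j * (Dc h j v x \<bullet> v (x + h *\<^sub>R e j))" j] u by simp
  moreover have "(\<Sum>x\<in>\<Omega>h. ((u (x + h *\<^sub>R e j) $ j) *\<^sub>R Dc h j v (x + h *\<^sub>R e j)) \<bullet> v x)
      = (\<Sum>x\<in>\<Omega>h. u x $ j * (Dc h j v x \<bullet> v (x - h *\<^sub>R e j)))"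
    using shift_plus[of "\<lambda>x. u x $ j * (Dc h j v x \<bullet> v (x - h *\<^sub>R e j))" j] u by simp
  moreover have "Dc h j v x \<bullet> v (x + h *\<^sub>R e j) + Dc h j v x \<bullet> v (x - h *\<^sub>R e j) = Dc h j (\<lambda>y. v y \<bullet> v y) x" for x
    by (simp add: Dc_def inner_diff_left inner_commute algebra_simps flip: inner_add_right)
  ultimately have "(\<Sum>x\<in>\<Omega>h. ((u (x - h *\<^sub>R e j) $ j) *\<^sub>R Dc h j v (x - h *\<^sub>R e j) +
         (u (x + h *\<^sub>R e j) $ j) *\<^sub>R Dc h j v (x + h *\<^sub>R e j)) \<bullet> v x)
      = (\<Sum>x\<in>\<Omega>h. u x $ j * Dc h j (\<lambda>y. v y \<bullet> v y) x)"
    unfolding inner_add_left sum.distrib by (simp flip: sum.distrib distrib_left)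
  then show ?thesis using Dc_adjoint[of "\<lambda>y. u y $ j" j "\<lambda>y. v y \<bullet> v y"] u by simp
qed

text \<open>The convection term is skew-symmetric because the advecting field is discretely solenoidal.\<close>

lemma conv_diff_energy:
  fixes v :: "real^3 \<Rightarrow> 'b::real_inner"
  assumes u: "supp_inner u" and div: "\<And>x. x \<in> \<Omega>h \<Longrightarrow> ddiv h u x = 0" and v: "supp_inner v"
  shows "(\<Sum>x\<in>inn. conv_diff h u v x \<bullet> v x) = - (\<Sum>j\<in>UNIV. \<Sum>x\<in>\<Omega>h. (norm (Dplus h j v x))\<^sup>2)"
proof -
  have "(\<Sum>j\<in>UNIV. \<Sum>x\<in>\<Omega>h. ((u (x - h *\<^sub>R e j) $ j) *\<^sub>R Dc h j v (x - h *\<^sub>R e j) +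
         (u (x + h *\<^sub>R e j) $ j) *\<^sub>R Dc h j v (x + h *\<^sub>R e j)) \<bullet> v x)
      = - (\<Sum>x\<in>\<Omega>h. ddiv h u x * (v x \<bullet> v x))"
    unfolding convection_energy[OF u] ddiv_def sum_distrib_right sum_negf
    by (rule arg_cong[where f = uminus]) (rule sum.swap)
  also have "\<dots> = 0" by (simp add: div)
  finally have conv: "(\<Sum>x\<in>\<Omega>h. \<Sum>j\<in>UNIV. ((u (x - h *\<^sub>R e j) $ j) *\<^sub>R Dc h j v (x - h *\<^sub>R e j) +
         (u (x + h *\<^sub>R e j) $ j) *\<^sub>R Dc h j v (x + h *\<^sub>R e j)) \<bullet> v x) = 0"
    by (subst sum.swap)
  have pointwise: "conv_diff h u v x \<bullet> v x
      = - (1/2) * (\<Sum>j\<in>UNIV. ((u (x - h *\<^sub>R e j) $ j) *\<^sub>R Dc h j v (x - h *\<^sub>R e j) +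
         (u (x + h *\<^sub>R e j) $ j) *\<^sub>R Dc h j v (x + h *\<^sub>R e j)) \<bullet> v x)
      + (\<Sum>j\<in>UNIV. Dsq h j v x \<bullet> v x)" for x
    unfolding conv_diff_def by (subst inner_add_left) (simp only: inner_scaleR_left inner_sum_left)
  have "(\<Sum>x\<in>inn. conv_diff h u v x \<bullet> v x) = (\<Sum>x\<in>\<Omega>h. conv_diff h u v x \<bullet> v x)"
    using v by (intro sum_inner_eq) auto
  also have "\<dots> = - (1/2) * 0 + (\<Sum>x\<in>\<Omega>h. \<Sum>j\<in>UNIV. Dsq h j v x \<bullet> v x)"
    unfolding pointwise sum.distrib by (simp only: conv flip: sum_distrib_left)
  also have "(\<Sum>x\<in>\<Omega>h. \<Sum>j\<in>UNIV. Dsq h j v x \<bullet> v x) = (\<Sum>j\<in>UNIV. \<Sum>x\<in>\<Omega>h. Dsq h j v x \<bullet> v x)"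
    by (rule sum.swap)
  finally show ?thesis by (simp add: Dsq_energy[OF v] sum_negf)
qed

lemma conv_diff_dissipative:
  fixes v :: "real^3 \<Rightarrow> 'b::real_inner"
  assumes "supp_inner u" "\<And>x. x \<in> \<Omega>h \<Longrightarrow> ddiv h u x = 0" "supp_inner v"
  shows "(\<Sum>x\<in>inn. conv_diff h u v x \<bullet> v x) \<le> 0"
  using conv_diff_energy[OF assms] by (simp add: sum_nonneg)

lemma ns_step_iff:
  "ns_step \<Omega> h \<tau> F u v \<longleftrightarrow>
     (\<forall>x\<in>inn. (v x - u x) /\<^sub>R \<tau> = conv_diff h u v x + F x) \<and> (\<forall>x\<in>bdry \<Omega> h. v x = 0)"
  by (simp add: ns_step_def conv_diff_def)

end

section \<open>The discrete Helmholtz projection\<close>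

lemma Dc_sum:
  "Dc h i (\<lambda>x. \<Sum>y\<in>S. c y *\<^sub>R g y x) x = (\<Sum>y\<in>S. c y *\<^sub>R Dc h i (g y) x)"
  by (simp add: Dc_def scaleR_sum_right algebra_simps flip: sum_subtractf)

lemma dgrad_sum:
  "dgrad h (\<lambda>x. \<Sum>y\<in>S. c y *\<^sub>R g y x) x = (\<Sum>y\<in>S. c y *\<^sub>R dgrad h (g y) x)"
  using Dc_sum[of h _ c g S x] by (simp add: vec_eq_iff dgrad_def sum_component)

lemma conv_diff_add: "conv_diff h u (\<lambda>x. a x + b x) x = conv_diff h u a x + conv_diff h u b x"
proof -
  have "Dc h j (\<lambda>x. a x + b x) x = Dc h j a x + Dc h j b x"
    "Dsq h j (\<lambda>x. a x + b x) x = Dsq h j a x + Dsq h j b x" for j x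
    by (simp_all add: Dc_def Dsq_def algebra_simps)
  then show ?thesis by (simp add: conv_diff_def scaleR_add_right scaleR_diff_right sum.distrib)
qed

lemma conv_diff_scaleR: "conv_diff h u (\<lambda>x. c *\<^sub>R a x) x = c *\<^sub>R conv_diff h u a x"
proof -
  have "Dc h j (\<lambda>x. c *\<^sub>R a x) x = c *\<^sub>R Dc h j a x" "Dsq h j (\<lambda>x. c *\<^sub>R a x) x = c *\<^sub>R Dsq h j a x" for j x
    by (simp_all add: Dc_def Dsq_def algebra_simps)
  then show ?thesis
    by (simp add: conv_diff_def scaleR_add_right scaleR_diff_right scaleR_sum_right mult_ac)
qed

lemma conv_diff_sum:
  "conv_diff h u (\<lambda>x. \<Sum>y\<in>S. c y *\<^sub>R g y x) x = (\<Sum>y\<in>S. c y *\<^sub>R conv_diff h u (g y) x)"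
proof (induction S rule: infinite_finite_induct)
  case (insert y S)
  then show ?case by (simp add: conv_diff_add conv_diff_scaleR)
qed (simp_all add: conv_diff_def Dc_def Dsq_def)

lemma Dc_diff: "Dc h i (\<lambda>x. a x - b x) x = Dc h i a x - Dc h i b x"
  by (simp add: Dc_def algebra_simps)

lemma dgrad_diff: "dgrad h (\<lambda>x. a x - b x) x = dgrad h a x - dgrad h b x"
  by (simp add: dgrad_def vec_eq_iff Dc_diff)

lemma ddiv_diff: "ddiv h (\<lambda>x. a x - b x) x = ddiv h a x - ddiv h b x"
  by (simp add: ddiv_def Dc_diff sum_subtractf)

lemma conv_diff_diff: "conv_diff h u (\<lambda>x. a x - b x) x = conv_diff h u a x - conv_diff h u b x"
  using conv_diff_add[of h u a "\<lambda>x. (- 1) *\<^sub>R b x" x] unfolding conv_diff_scaleR by simp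

lemma conv_diff_component: "conv_diff h u v x $ k = conv_diff h u (\<lambda>x. v x $ k) x"
  by (simp add: conv_diff_def Dc_def Dsq_def sum_component)

definition delta :: "'a \<Rightarrow> 'a \<Rightarrow> real" where
  "delta y x = (if x = y then 1 else 0)"

lemma sum_delta_scaleR:
  assumes "finite S"
  shows "(\<Sum>y\<in>S. c y *\<^sub>R delta y x) = (if x \<in> S then c x else 0)"
  using assms by (simp add: delta_def if_distrib[of "\<lambda>t. _ * t"] cong: if_cong)

text \<open>For grid points the floor is exact, so that this is the index of the parity class.\<close>

definition parity_vec :: "real \<Rightarrow> real^3 \<Rightarrow> bool^3" where
  "parity_vec h x = (\<chi> i. even \<lfloor>x $ i / h\<rfloor>)"

lemma parity_vec_class: "h > 0 \<Longrightarrow> x \<in> parity_class h p \<Longrightarrow> parity_vec h x = p"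
  by (auto simp: parity_class_def parity_vec_def vec_eq_iff)

text \<open>The two points differ by exactly 2 h in one coordinate. Hence any function of the parity
  class drops out of a centred difference.\<close>

lemma parity_vec_step:
  assumes "h > 0"
  shows "parity_vec h (x + h *\<^sub>R e i) = parity_vec h (x - h *\<^sub>R e i)"
proof -
  have "(x + h *\<^sub>R e i) $ j / h = (x - h *\<^sub>R e i) $ j / h + (if j = i then 2 else 0)" for j
    using assms by (simp add: axis_def field_simps)
  then show ?thesis by (simp add: parity_vec_def vec_eq_iff)
qed

context mesh
begin

lemma helmholtz_decomp_iff:
  "helmholtz_decomp \<Omega> h u w \<phi> \<longleftrightarrow> supp_inner w \<and> \<phi> \<in> gridfun \<Omega> h \<and> (\<forall>x\<in>\<Omega>h. ddiv h w x = 0) \<and>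
     (\<forall>x\<in>inn. w x + dgrad h \<phi> x = u x) \<and> (\<forall>p. (\<Sum>x\<in>core_class \<Omega> h p. \<phi> x) = 0)"
  unfolding helmholtz_decomp_def using supp_inner_iff[of w] by blast

text \<open>Pythagoras: the difference of the solenoidal parts is orthogonal to the difference of
  the gradients. Equal data give uniqueness, zero data the norm bound, and convergent data the
  continuity of the projection.\<close>

lemma helmholtz_decomp_contraction:
  assumes "helmholtz_decomp \<Omega> h u w \<phi>" "helmholtz_decomp \<Omega> h u' w' \<phi>'"
  shows "(\<Sum>x\<in>inn. (norm (w x - w' x))\<^sup>2) \<le> (\<Sum>x\<in>inn. (norm (u x - u' x))\<^sup>2)"
proof -
  define z where "z x = w x - w' x" for x
  define g where "g x = dgrad h (\<lambda>x. \<phi> x - \<phi>' x) x" for x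
  have "supp_inner z" using assms by (simp add: z_def helmholtz_decomp_iff)
  then have orth: "(\<Sum>x\<in>inn. z x \<bullet> g x) = 0"
    unfolding g_def using assms
    by (subst grad_div_adjoint) (auto simp: z_def[abs_def] ddiv_diff helmholtz_decomp_iff)
  have "(norm (u x - u' x))\<^sup>2 = (norm (z x))\<^sup>2 + (norm (g x))\<^sup>2 + 2 * (z x \<bullet> g x)" if "x \<in> inn" for x
  proof -
    have "u x = w x + dgrad h \<phi> x" "u' x = w' x + dgrad h \<phi>' x"
      using assms that by (simp_all add: helmholtz_decomp_iff)
    then have "u x - u' x = z x + g x"
      by (simp add: z_def g_def dgrad_diff)
    then show ?thesis by (simp add: power2_norm_eq_inner inner_add_left inner_add_right inner_commute)
  qed
  then have "(\<Sum>x\<in>inn. (norm (u x - u' x))\<^sup>2) = (\<Sum>x\<in>inn. (norm (z x))\<^sup>2) + (\<Sum>x\<in>inn. (norm (g x))\<^sup>2)"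
    by (simp add: sum.distrib orth flip: sum_distrib_left)
  then show ?thesis by (simp add: z_def sum_nonneg)
qed

lemma helmholtz_decomp_unique:
  assumes "helmholtz_decomp \<Omega> h u w \<phi>" "helmholtz_decomp \<Omega> h u w' \<phi>'"
  shows "w = w'"
proof
  fix x
  have "(\<Sum>x\<in>inn. (norm (w x - w' x))\<^sup>2) = 0"
    using helmholtz_decomp_contraction[OF assms] by (intro antisym sum_nonneg) auto
  then show "w x = w' x"
    using assms finite_inner by (cases "x \<in> inn") (auto simp: sum_nonneg_eq_0_iff helmholtz_decomp_iff)
qed

text \<open>\<open>w\<close> is the residual of the least-squares fit of \<open>u\<close> by
  gradients of the point functions \<open>delta y\<close>. Orthogonality to the gradient of
  \<open>delta j\<close> says, by the adjoint relation, that the divergence of \<open>w\<close>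
  vanishes at \<open>j\<close>.\<close>

lemma helmholtz_decomp_exists: "\<exists>w \<phi>. helmholtz_decomp \<Omega> h u w \<phi>"
proof -
  obtain c where c: "\<forall>j\<in>\<Omega>h. (\<Sum>x\<in>inn. (u x - (\<Sum>y\<in>\<Omega>h. c y *\<^sub>R dgrad h (delta y) x)) \<bullet> dgrad h (delta j) x) = 0"
    using normal_equations_solvable[OF finite_disc finite_inner, of u "\<lambda>y. dgrad h (delta y)"] by blast
  define \<phi>\<^sub>0 where "\<phi>\<^sub>0 x = (\<Sum>y\<in>\<Omega>h. c y *\<^sub>R delta y x)" for x
  have grad: "dgrad h \<phi>\<^sub>0 x = (\<Sum>y\<in>\<Omega>h. c y *\<^sub>R dgrad h (delta y) x)" for x
    unfolding \<phi>\<^sub>0_def[abs_def] by (rule dgrad_sum)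
  define w where "w x = (if x \<in> inn then u x - dgrad h \<phi>\<^sub>0 x else 0)" for x
  have w: "supp_inner w" by (simp add: w_def)
  have div: "ddiv h w j = 0" if "j \<in> \<Omega>h" for j
  proof -
    have "(\<Sum>x\<in>inn. w x \<bullet> dgrad h (delta j) x) = 0"
      using c that by (simp add: w_def grad)
    moreover have "(\<Sum>x\<in>\<Omega>h. delta j x * ddiv h w x) = ddiv h w j"
      using that finite_disc by (simp add: delta_def if_distrib[of "\<lambda>t. t * _"] cong: if_cong)
    ultimately show ?thesis using grad_div_adjoint[OF w, of "delta j"] by simp
  qed
  \<comment> \<open>The mean over each class is subtracted from the potential. For an empty class
    the sum to be annihilated is zero anyway.\<close>
  define m where "m p = (\<Sum>x\<in>core_class \<Omega> h p. \<phi>\<^sub>0 x) / card (core_class \<Omega> h p)" for p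
  define \<phi> where "\<phi> x = (if x \<in> \<Omega>h then \<phi>\<^sub>0 x - m (parity_vec h x) else 0)" for x
  have core: "core_class \<Omega> h p \<subseteq> \<Omega>h" for p
    using inner_subset by (auto simp: core_class_def core_def)
  have "(\<Sum>x\<in>core_class \<Omega> h p. \<phi> x) = 0" for p
  proof -
    have "(\<Sum>x\<in>core_class \<Omega> h p. \<phi> x) = (\<Sum>x\<in>core_class \<Omega> h p. \<phi>\<^sub>0 x - m p)"
      using core h by (intro sum.cong) (auto simp: \<phi>_def core_class_def parity_vec_class)
    also have "\<dots> = 0"
      using finite_subset[OF core finite_disc, of p] by (simp add: sum_subtractf m_def)
    finally show ?thesis .
  qed
  \<comment> \<open>The two neighbours of an inner point lie in \<Omega>h and share their parity, so
    the subtracted means cancel.\<close>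
  moreover have "dgrad h \<phi> x = dgrad h \<phi>\<^sub>0 x" if "x \<in> inn" for x
    using inner_step[OF that] by (simp add: dgrad_def Dc_def \<phi>_def vec_eq_iff parity_vec_step[OF h])
  ultimately have "helmholtz_decomp \<Omega> h u w \<phi>"
    using w div by (simp add: helmholtz_decomp_iff gridfun_def \<phi>_def w_def)
  then show ?thesis by blast
qed

abbreviation "proj \<equiv> helmholtz_proj \<Omega> h"

lemma proj_decomp: "\<exists>\<phi>. helmholtz_decomp \<Omega> h u (proj u) \<phi>"
proof -
  have "\<exists>!w. \<exists>\<phi>. helmholtz_decomp \<Omega> h u w \<phi>"
    using helmholtz_decomp_exists helmholtz_decomp_unique by blast
  then show ?thesis unfolding helmholtz_proj_def by (rule theI')
qed

lemma proj_supp: "supp_inner (proj u)"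
  using proj_decomp[of u] by (auto simp: helmholtz_decomp_iff)

lemma proj_div: "x \<in> \<Omega>h \<Longrightarrow> ddiv h (proj u) x = 0"
  using proj_decomp[of u] by (auto simp: helmholtz_decomp_iff)

lemma proj_contraction:
  "(\<Sum>x\<in>inn. (norm (proj u x - proj v x))\<^sup>2) \<le> (\<Sum>x\<in>inn. (norm (u x - v x))\<^sup>2)"
proof -
  obtain \<phi> \<psi> where "helmholtz_decomp \<Omega> h u (proj u) \<phi>" "helmholtz_decomp \<Omega> h v (proj v) \<psi>"
    using proj_decomp by meson
  then show ?thesis by (rule helmholtz_decomp_contraction)
qed

lemma proj_norm_le: "(\<Sum>x\<in>inn. (norm (proj u x))\<^sup>2) \<le> (\<Sum>x\<in>inn. (norm (u x))\<^sup>2)"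
proof -
  have "helmholtz_decomp \<Omega> h (\<lambda>x. 0) (\<lambda>x. 0) (\<lambda>x. 0)"
    by (simp add: helmholtz_decomp_iff gridfun_def ddiv_def dgrad_def Dc_def vec_eq_iff)
  moreover obtain \<phi> where "helmholtz_decomp \<Omega> h u (proj u) \<phi>" using proj_decomp by meson
  ultimately show ?thesis using helmholtz_decomp_contraction[of u "proj u" \<phi> "\<lambda>x. 0" "\<lambda>x. 0" "\<lambda>x. 0"] by simp
qed

section \<open>The implicit time step\<close>

text \<open>Testing with \<open>d\<close>: convection and diffusion contribute nothing positive, and
  Young's inequality absorbs half of the left side. Applied to the difference of two steps, it
  yields uniqueness and continuity at once.\<close>

lemma step_residual_bound:
  fixes d r :: "real^3 \<Rightarrow> 'b::real_inner"
  assumes "supp_inner u" "\<And>x. x \<in> \<Omega>h \<Longrightarrow> ddiv h u x = 0" "supp_inner d" and \<tau>: "\<tau> > 0"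
    and eq: "\<And>x. x \<in> inn \<Longrightarrow> d x /\<^sub>R \<tau> = conv_diff h u d x + r x"
  shows "(\<Sum>x\<in>inn. (norm (d x))\<^sup>2) \<le> \<tau>\<^sup>2 * (\<Sum>x\<in>inn. (norm (r x))\<^sup>2)"
proof -
  have "(norm (d x))\<^sup>2 \<le> 2 * \<tau> * (conv_diff h u d x \<bullet> d x) + \<tau>\<^sup>2 * (norm (r x))\<^sup>2" if "x \<in> inn" for x
  proof -
    have "(norm (d x))\<^sup>2 = \<tau> * ((d x /\<^sub>R \<tau>) \<bullet> d x)" using \<tau> by (simp add: power2_norm_eq_inner)
    also have "\<dots> = \<tau> * (conv_diff h u d x \<bullet> d x) + \<tau> * (r x \<bullet> d x)"
      by (simp add: eq[OF that] inner_add_left distrib_left)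
    finally have "(norm (d x))\<^sup>2 = \<tau> * (conv_diff h u d x \<bullet> d x) + \<tau> * (r x \<bullet> d x)" .
    moreover have "0 \<le> (norm (d x - \<tau> *\<^sub>R r x))\<^sup>2" by simp
    then have "2 * (\<tau> * (r x \<bullet> d x)) \<le> (norm (d x))\<^sup>2 + \<tau>\<^sup>2 * (norm (r x))\<^sup>2"
      unfolding power2_norm_eq_inner
      by (simp add: inner_diff_left inner_diff_right inner_commute power2_eq_square mult.assoc)
    ultimately show ?thesis by linarith
  qed
  then have "(\<Sum>x\<in>inn. (norm (d x))\<^sup>2)
      \<le> 2 * \<tau> * (\<Sum>x\<in>inn. conv_diff h u d x \<bullet> d x) + \<tau>\<^sup>2 * (\<Sum>x\<in>inn. (norm (r x))\<^sup>2)"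
    unfolding sum_distrib_left sum.distrib[symmetric] by (intro sum_mono) auto
  also have "2 * \<tau> * (\<Sum>x\<in>inn. conv_diff h u d x \<bullet> d x) \<le> 0"
    using conv_diff_dissipative[OF assms(1-3)] \<tau> by (simp add: mult_nonneg_nonpos)
  finally show ?thesis by simp
qed

text \<open>The least-squares residual \<open>r\<close> is orthogonal to the range of
  \<open>L\<close> on functions supported in \<open>inn\<close>, in particular to
  \<open>L r\<close>. Dissipativity bounds the pairing of \<open>r\<close> with \<open>L r\<close>
  below by |r|^2 / \<tau>, so \<open>r\<close> is zero.\<close>

lemma resolvent_solvable:
  fixes b :: "real^3 \<Rightarrow> real"
  assumes u: "supp_inner u" "\<And>x. x \<in> \<Omega>h \<Longrightarrow> ddiv h u x = 0" and \<tau>: "\<tau> > 0"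
  shows "\<exists>\<phi>. supp_inner \<phi> \<and> (\<forall>x\<in>inn. \<phi> x / \<tau> - conv_diff h u \<phi> x = b x)"
proof -
  define L where "L \<phi> x = \<phi> x / \<tau> - conv_diff h u \<phi> x" for \<phi> :: "real^3 \<Rightarrow> real" and x
  have L_sum: "L (\<lambda>x. \<Sum>y\<in>inn. c y *\<^sub>R delta y x) x = (\<Sum>y\<in>inn. c y *\<^sub>R L (delta y) x)" for c x
    unfolding L_def conv_diff_sum by (simp add: sum_divide_distrib right_diff_distrib sum_subtractf)
  obtain c where c: "\<forall>j\<in>inn. (\<Sum>x\<in>inn. (b x - (\<Sum>y\<in>inn. c y *\<^sub>R L (delta y) x)) \<bullet> L (delta j) x) = 0"
    using normal_equations_solvable[OF finite_inner finite_inner, of b "\<lambda>y. L (delta y)"] by blast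
  define \<phi> where "\<phi> x = (\<Sum>y\<in>inn. c y *\<^sub>R delta y x)" for x
  have L\<phi>: "L \<phi> x = (\<Sum>y\<in>inn. c y *\<^sub>R L (delta y) x)" for x
    unfolding \<phi>_def[abs_def] by (rule L_sum)
  have \<phi>: "supp_inner \<phi>" unfolding \<phi>_def by (simp only: sum_delta_scaleR[OF finite_inner]) simp
  define r where "r x = (if x \<in> inn then b x - L \<phi> x else 0)" for x
  have r: "supp_inner r" by (simp add: r_def)
  have orth: "(\<Sum>x\<in>inn. r x * L (delta j) x) = 0" if "j \<in> inn" for j
    using c that by (simp add: r_def L\<phi>)
  have r_eq: "r = (\<lambda>x. \<Sum>y\<in>inn. r y *\<^sub>R delta y x)"
    unfolding sum_delta_scaleR[OF finite_inner] by (auto simp: r_def)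
  have "L r x = (\<Sum>y\<in>inn. r y *\<^sub>R L (delta y) x)" for x
    using L_sum[of r x] unfolding r_eq[symmetric] .
  then have "(\<Sum>x\<in>inn. r x * L r x) = (\<Sum>x\<in>inn. \<Sum>y\<in>inn. r y * (r x * L (delta y) x))"
    by (simp add: sum_distrib_left mult.left_commute)
  also have "\<dots> = (\<Sum>y\<in>inn. r y * (\<Sum>x\<in>inn. r x * L (delta y) x))"
    unfolding sum_distrib_left by (rule sum.swap)
  also have "\<dots> = 0" by (simp add: orth)
  finally have "(\<Sum>x\<in>inn. (r x)\<^sup>2) / \<tau> = (\<Sum>x\<in>inn. conv_diff h u r x \<bullet> r x)"
    by (simp add: L_def right_diff_distrib sum_subtractf sum_divide_distrib power2_eq_square mult.commute)
  then have "(\<Sum>x\<in>inn. (r x)\<^sup>2) / \<tau> \<le> 0" using conv_diff_dissipative[OF u r] by simp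
  then have "(\<Sum>x\<in>inn. (r x)\<^sup>2) \<le> 0" using \<tau> by (auto simp: divide_le_0_iff)
  then have "(\<Sum>x\<in>inn. (r x)\<^sup>2) = 0" by (intro antisym sum_nonneg) auto
  then have "\<forall>x\<in>inn. r x = 0" using finite_inner by (simp add: sum_nonneg_eq_0_iff)
  then show ?thesis using \<phi> by (auto simp: r_def L_def)
qed

text \<open>The state carried along is the tilde field; projecting it inside the step turns the
  coupled scheme into a one-step recursion.\<close>

definition is_step :: "real \<Rightarrow> (real^3 \<Rightarrow> real^3) \<Rightarrow> (real^3 \<Rightarrow> real^3) \<Rightarrow> (real^3 \<Rightarrow> real^3) \<Rightarrow> bool" where
  "is_step \<tau> F v v' \<longleftrightarrow> v' \<in> gridfun \<Omega> h \<and> ns_step \<Omega> h \<tau> F (proj v) v'"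

lemma is_step_iff:
  "is_step \<tau> F v v' \<longleftrightarrow> supp_inner v' \<and>
     (\<forall>x\<in>inn. (v' x - proj v x) /\<^sub>R \<tau> = conv_diff h (proj v) v' x + F x)"
  unfolding is_step_def ns_step_iff using supp_inner_iff[of v'] by blast

lemma is_step_exists:
  assumes "\<tau> > 0"
  shows "\<exists>v'. is_step \<tau> F v v'"
proof -
  have "\<forall>k. \<exists>\<phi>. supp_inner \<phi> \<and> (\<forall>x\<in>inn. \<phi> x / \<tau> - conv_diff h (proj v) \<phi> x = proj v x $ k / \<tau> + F x $ k)"
    by (intro allI resolvent_solvable proj_supp proj_div assms)
  then obtain \<phi> where "\<forall>k. supp_inner (\<phi> k) \<and>
      (\<forall>x\<in>inn. \<phi> k x / \<tau> - conv_diff h (proj v) (\<phi> k) x = proj v x $ k / \<tau> + F x $ k)"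
    unfolding choice_iff by blast
  then have \<phi>: "\<And>k. supp_inner (\<phi> k)"
    "\<And>k x. x \<in> inn \<Longrightarrow> \<phi> k x / \<tau> - conv_diff h (proj v) (\<phi> k) x = proj v x $ k / \<tau> + F x $ k"
    by auto
  define v' where "v' x = (\<chi> k. \<phi> k x)" for x
  have "((v' x - proj v x) /\<^sub>R \<tau>) $ k = (conv_diff h (proj v) v' x + F x) $ k" if "x \<in> inn" for x k
    using \<phi>(2)[OF that, of k] by (simp add: conv_diff_component v'_def divide_inverse algebra_simps)
  then have "is_step \<tau> F v v'"
    using \<phi>(1) by (simp add: is_step_iff vec_eq_iff v'_def)
  then show ?thesis by blast
qed

text \<open>The difference solves a step equation with advecting field \<open>proj w\<close>; the
  change of advecting field acts on the fixed \<open>v'\<close> and is moved into the source. With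
  \<open>v\<close> and \<open>v'\<close> held fixed, the right side depends on \<open>w\<close>
  alone, so it tends to zero without any bound on \<open>w'\<close>.\<close>

lemma is_step_dist:
  assumes \<tau>: "\<tau> > 0" and "is_step \<tau> F v v'" "is_step \<tau> F w w'"
  shows "(\<Sum>x\<in>inn. (norm (w' x - v' x))\<^sup>2) \<le> \<tau>\<^sup>2 * (\<Sum>x\<in>inn. (norm
    ((proj w x - proj v x) /\<^sub>R \<tau> + (conv_diff h (proj w) v' x - conv_diff h (proj v) v' x)))\<^sup>2)"
proof (rule step_residual_bound[OF proj_supp proj_div])
  show "supp_inner (\<lambda>x. w' x - v' x)" using assms by (simp add: is_step_iff)
  fix x assume "x \<in> inn"
  then have "(v' x - proj v x) /\<^sub>R \<tau> = conv_diff h (proj v) v' x + F x"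
    "(w' x - proj w x) /\<^sub>R \<tau> = conv_diff h (proj w) w' x + F x"
    using assms by (auto simp: is_step_iff)
  then show "(w' x - v' x) /\<^sub>R \<tau> = conv_diff h (proj w) (\<lambda>x. w' x - v' x) x
      + ((proj w x - proj v x) /\<^sub>R \<tau> + (conv_diff h (proj w) v' x - conv_diff h (proj v) v' x))"
    by (simp add: conv_diff_diff scaleR_diff_right algebra_simps)
qed (use \<tau> in auto)

lemma is_step_unique:
  assumes "\<tau> > 0" "is_step \<tau> F v v'" "is_step \<tau> F v w'"
  shows "v' = w'"
proof
  fix x
  have "(\<Sum>x\<in>inn. (norm (w' x - v' x))\<^sup>2) = 0"
    using is_step_dist[OF assms] by (intro antisym sum_nonneg) auto
  then show "v' x = w' x"
    using assms finite_inner by (cases "x \<in> inn") (auto simp: sum_nonneg_eq_0_iff is_step_iff)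
qed

lemma sum_squares_tendsto_zero:
  fixes d :: "nat \<Rightarrow> real^3 \<Rightarrow> 'b::real_normed_vector"
  assumes "(\<lambda>m. \<Sum>x\<in>inn. (norm (d m x))\<^sup>2) \<longlonglongrightarrow> 0" "\<And>m. supp_inner (d m)"
  shows "(\<lambda>m. d m x) \<longlonglongrightarrow> 0"
proof (cases "x \<in> inn")
  case True
  have "norm (d m x) \<le> sqrt (\<Sum>x\<in>inn. (norm (d m x))\<^sup>2)" for m
    using True finite_inner by (intro real_le_rsqrt member_le_sum) auto
  moreover have lim: "(\<lambda>m. sqrt (\<Sum>x\<in>inn. (norm (d m x))\<^sup>2)) \<longlonglongrightarrow> 0"
    using tendsto_real_sqrt[OF assms(1)] by simp
  ultimately show ?thesis by (intro Lim_null_comparison[OF _ lim]) auto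
qed (simp add: assms(2))

lemma proj_tendsto:
  assumes "\<And>y. (\<lambda>m. V m y) \<longlonglongrightarrow> v y"
  shows "(\<lambda>m. proj (V m) x) \<longlonglongrightarrow> proj v x"
proof -
  have "(\<lambda>m. \<Sum>x\<in>inn. (norm (V m x - v x))\<^sup>2) \<longlonglongrightarrow> (\<Sum>x\<in>inn. (norm (v x - v x))\<^sup>2)"
    by (intro tendsto_intros assms)
  then have lim: "(\<lambda>m. \<Sum>x\<in>inn. (norm (V m x - v x))\<^sup>2) \<longlonglongrightarrow> 0" by simp
  have "(\<lambda>m. \<Sum>x\<in>inn. (norm (proj (V m) x - proj v x))\<^sup>2) \<longlonglongrightarrow> 0"
    by (rule Lim_null_comparison[OF _ lim]) (simp add: sum_nonneg proj_contraction)
  then have "(\<lambda>m. proj (V m) x - proj v x) \<longlonglongrightarrow> 0"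
    by (rule sum_squares_tendsto_zero) (simp add: proj_supp)
  then show ?thesis by (rule LIM_zero_cancel)
qed

lemma is_step_tendsto:
  assumes \<tau>: "\<tau> > 0" and V: "\<And>y. (\<lambda>m. V m y) \<longlonglongrightarrow> v y"
    and step: "\<And>m. is_step \<tau> F (V m) (V' m)" "is_step \<tau> F v v'"
  shows "(\<lambda>m. V' m x) \<longlonglongrightarrow> v' x"
proof -
  define res where "res m x = (proj (V m) x - proj v x) /\<^sub>R \<tau> +
      (conv_diff h (proj (V m)) v' x - conv_diff h (proj v) v' x)" for m x
  have "(\<lambda>m. proj (V m) x) \<longlonglongrightarrow> proj v x" for x
    by (rule proj_tendsto[OF V])
  moreover from this have "(\<lambda>m. conv_diff h (proj (V m)) v' x) \<longlonglongrightarrow> conv_diff h (proj v) v' x" for x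
    unfolding conv_diff_def by (intro tendsto_intros)
  ultimately have "(\<lambda>m. res m x) \<longlonglongrightarrow> (proj v x - proj v x) /\<^sub>R \<tau> +
      (conv_diff h (proj v) v' x - conv_diff h (proj v) v' x)" for x
    unfolding res_def by (intro tendsto_intros)
  then have "(\<lambda>m. res m x) \<longlonglongrightarrow> 0" for x by simp
  then have "(\<lambda>m. \<tau>\<^sup>2 * (\<Sum>x\<in>inn. (norm (res m x))\<^sup>2)) \<longlonglongrightarrow> \<tau>\<^sup>2 * (\<Sum>x\<in>inn. (norm (0::real^3))\<^sup>2)"
    by (intro tendsto_intros)
  then have lim: "(\<lambda>m. \<tau>\<^sup>2 * (\<Sum>x\<in>inn. (norm (res m x))\<^sup>2)) \<longlonglongrightarrow> 0" by simp
  have "(\<Sum>x\<in>inn. (norm (V' m x - v' x))\<^sup>2) \<le> \<tau>\<^sup>2 * (\<Sum>x\<in>inn. (norm (res m x))\<^sup>2)" for m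
    unfolding res_def by (rule is_step_dist[OF \<tau> step(2) step(1)])
  then have "(\<lambda>m. \<Sum>x\<in>inn. (norm (V' m x - v' x))\<^sup>2) \<longlonglongrightarrow> 0"
    by (intro Lim_null_comparison[OF _ lim]) (simp add: sum_nonneg)
  moreover have "supp_inner (\<lambda>x. V' m x - v' x)" for m using step by (simp add: is_step_iff)
  ultimately have "(\<lambda>m. V' m x - v' x) \<longlonglongrightarrow> 0"
    by (rule sum_squares_tendsto_zero)
  then show ?thesis by (rule LIM_zero_cancel)
qed

end

section \<open>Estimates for the averaged force\<close>

text \<open>Neighbouring closed cells share faces; passing to the open boxes almost everywhere
  removes the overlap.\<close>

lemma AE_cbox_imp_box: "AE x in lborel. x \<in> cbox a b \<longrightarrow> x \<in> box a (b::'a::euclidean_space)"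
proof -
  have "emeasure lborel (cbox a b - box a b) = emeasure lborel (cbox a b) - emeasure lborel (box a b)"
    by (intro emeasure_Diff box_subset_cbox) (auto simp: emeasure_lborel_box_eq)
  also have "\<dots> = 0" by (simp add: emeasure_lborel_box_eq emeasure_lborel_cbox_eq)
  finally have "cbox a b - box a b \<in> null_sets lborel" by auto
  from AE_not_in[OF this] show ?thesis by eventually_elim auto
qed

lemma set_integral_Times:
  fixes g :: "'a::euclidean_space \<times> 'b::euclidean_space \<Rightarrow> 'c::{banach, second_countable_topology}"
  assumes "set_integrable lborel (I \<times> Q) g"
  shows "(LINT t:I|lborel. LINT y:Q|lborel. g (t, y)) = (LINT p:I \<times> Q|lborel. g p)"
proof -
  have "integrable (lborel \<Otimes>\<^sub>M lborel) (\<lambda>p. indicator (I \<times> Q) p *\<^sub>R g p)"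
    using assms by (simp add: set_integrable_def lborel_prod)
  from lborel_pair.integral_fst'[OF this] show ?thesis
    by (simp add: set_lebesgue_integral_def lborel_prod indicator_times flip: integral_scaleR_right scaleR_scaleR)
qed

text \<open>The variance of \<open>g\<close> on \<open>B\<close> is nonnegative.\<close>

lemma norm_average_sq_le:
  fixes g :: "'a \<Rightarrow> 'b::euclidean_space"
  assumes B: "B \<in> sets M" "emeasure M B = ennreal \<mu>" and \<mu>: "\<mu> > 0"
    and g: "set_integrable M B g" and g2: "set_integrable M B (\<lambda>x. (norm (g x))\<^sup>2)"
  shows "\<mu> * (norm ((LINT x:B|M. g x) /\<^sub>R \<mu>))\<^sup>2 \<le> (LINT x:B|M. (norm (g x))\<^sup>2)"
proof -
  define c where "c = (LINT x:B|M. g x) /\<^sub>R \<mu>"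
  have c: "(LINT x:B|M. g x) = \<mu> *\<^sub>R c" using \<mu> by (simp add: c_def)
  have const: "set_integrable M B (\<lambda>x. (norm c)\<^sup>2)" "(LINT x:B|M. (norm c)\<^sup>2) = \<mu> * (norm c)\<^sup>2"
    using B \<mu> by (auto simp: set_integrable_def set_lebesgue_integral_def measure_def)
  have inner: "set_integrable M B (\<lambda>x. 2 * (g x \<bullet> c))" "(LINT x:B|M. 2 * (g x \<bullet> c)) = 2 * (\<mu> *\<^sub>R c \<bullet> c)"
    using integrable_inner_left[of c M "\<lambda>x. indicator B x *\<^sub>R g x"] integral_inner_left[of c M "\<lambda>x. indicator B x *\<^sub>R g x"]
      integrable_mult_right[of 2 M "\<lambda>x. indicator B x * (g x \<bullet> c)"] g c
    by (auto simp: set_integrable_def set_lebesgue_integral_def mult.left_commute)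
  have "0 \<le> (LINT x:B|M. (norm (g x - c))\<^sup>2)"
    unfolding set_lebesgue_integral_def by (intro integral_nonneg_AE) auto
  also have "\<dots> = (LINT x:B|M. (norm (g x))\<^sup>2 + (norm c)\<^sup>2 - 2 * (g x \<bullet> c))"
    by (simp add: power2_norm_eq_inner inner_diff_left inner_diff_right inner_commute algebra_simps)
  also have "\<dots> = (LINT x:B|M. (norm (g x))\<^sup>2) + \<mu> * (norm c)\<^sup>2 - 2 * (\<mu> *\<^sub>R c \<bullet> c)"
    using const inner g2 by (simp add: set_integral_diff set_integral_add)
  finally show ?thesis by (simp add: c_def[symmetric] power2_norm_eq_inner)
qed

lemma L2loc_set_integrable_sq:
  assumes "L2loc \<Omega> f" "B \<in> sets borel" "B \<subseteq> {0..T} \<times> \<Omega>"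
  shows "set_integrable lborel B (\<lambda>(t, x). (norm (f t x))\<^sup>2)"
proof (cases "T \<ge> 0")
  case True
  then show ?thesis using assms set_integrable_subset[of lborel "{0..T} \<times> \<Omega>" _ B] by (auto simp: L2loc_def)
next
  case False
  then show ?thesis using assms by (simp add: set_integrable_def)
qed

text \<open>On a bounded set the constant 1 is integrable, so a \<le> 1 + a^2 lets square
  integrability dominate.\<close>

lemma L2loc_set_integrable:
  assumes f: "L2loc \<Omega> f" and B: "B \<in> sets borel" "B \<subseteq> {0..T} \<times> \<Omega>" "bounded B"
  shows "set_integrable lborel B (\<lambda>(t, x). f t x)"
proof (rule set_integrable_bound)
  have "set_integrable lborel B (\<lambda>_. 1 :: real)"
    using emeasure_bounded_finite[OF B(3)] B by (simp add: set_integrable_def)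
  then show "set_integrable lborel B (\<lambda>p. 1 + (case p of (t, x) \<Rightarrow> (norm (f t x))\<^sup>2))"
    using L2loc_set_integrable_sq[OF f B(1,2)] by (intro set_integral_add)
  have "B \<subseteq> {0..} \<times> \<Omega>" using B(2) by auto
  then have "(\<lambda>p. indicator B p *\<^sub>R (case p of (t, x) \<Rightarrow> f t x))
      = (\<lambda>p. indicator B p *\<^sub>R (indicator ({0..} \<times> \<Omega>) p *\<^sub>R (case p of (t, x) \<Rightarrow> f t x)))"
    by (auto simp: indicator_def fun_eq_iff)
  moreover have "(\<lambda>p. indicator ({0..} \<times> \<Omega>) p *\<^sub>R (case p of (t, x) \<Rightarrow> f t x)) \<in> borel_measurable lborel"
    using f by (simp add: L2loc_def set_borel_measurable_def)
  ultimately show "set_borel_measurable lborel B (\<lambda>(t, x). f t x)"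
    unfolding set_borel_measurable_def using B(1)
    by (metis (no_types) borel_measurable_indicator borel_measurable_scaleR sets_lborel)
  have "a \<le> 1 + a\<^sup>2" for a :: real
    using sum_squares_ge_zero[of "a - 1/2" 0] by (simp add: power2_eq_square algebra_simps)
  then show "AE p in lborel. p \<in> B \<longrightarrow> norm (case p of (t, x) \<Rightarrow> f t x)
      \<le> norm (1 + (case p of (t, x) \<Rightarrow> (norm (f t x))\<^sup>2))"
    by (auto simp: add_nonneg_nonneg abs_of_nonneg)
qed

lemma emeasure_cube:
  assumes "r > 0"
  shows "emeasure lborel (cube r x) = ennreal (r^3)"
proof -
  have "emeasure lborel (cube r x) = (\<Prod>b\<in>Basis. ((\<chi> i. x $ i + r / 2) - (\<chi> i. x $ i - r / 2)) \<bullet> b)"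
    unfolding cube_def using assms by (intro emeasure_lborel_cbox) (auto simp: Basis_vec_def inner_axis)
  also have "(\<Prod>b\<in>Basis. ((\<chi> i. x $ i + r / 2) - (\<chi> i. x $ i - r / 2)) \<bullet> b) = (\<Prod>b\<in>(Basis :: (real^3) set). r)"
    by (intro prod.cong) (auto simp: Basis_vec_def inner_axis)
  finally show ?thesis by simp
qed

lemma sets_cube: "cube r x \<in> sets borel"
  by (simp add: cube_def)

section \<open>Space-time cells and the averaged force\<close>

context mesh
begin

lemma cube_subset: "x \<in> \<Omega>h \<Longrightarrow> cube h x \<subseteq> \<Omega>"
proof -
  assume x: "x \<in> \<Omega>h"
  have "cube h x \<subseteq> cube (4 * h) x"
  proof
    fix y assume "y \<in> cube h x"
    then have "x $ i - h / 2 \<le> y $ i \<and> y $ i \<le> x $ i + h / 2" for i by (simp add: cube_def mem_box_cart)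
    then have "x $ i - 4 * h / 2 \<le> y $ i \<and> y $ i \<le> x $ i + 4 * h / 2" for i using h by (smt (verit) field_sum_of_halves)
    then show "y \<in> cube (4 * h) x" by (simp add: cube_def mem_box_cart)
  qed
  then show ?thesis using x by (auto simp: disc_def)
qed

definition cell :: "real \<Rightarrow> nat \<times> (real^3) \<Rightarrow> (real \<times> (real^3)) set" where
  "cell \<tau> j = (case j of (n, x) \<Rightarrow> {\<tau> * real n..\<tau> * (real n + 1)} \<times> cube h x)"

lemma cell_eq_cbox:
  "cell \<tau> (n, x) = cbox (\<tau> * real n, \<chi> i. x $ i - h / 2) (\<tau> * (real n + 1), \<chi> i. x $ i + h / 2)"
  by (simp add: cell_def cube_def cbox_Pair_eq)

lemma cell_subset: "x \<in> \<Omega>h \<Longrightarrow> \<tau> > 0 \<Longrightarrow> \<tau> * (real n + 1) \<le> T \<Longrightarrow> cell \<tau> (n, x) \<subseteq> {0..T} \<times> \<Omega>"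
  using cube_subset[of x] order_trans[of 0 "\<tau> * real n"] by (auto simp: cell_def)

text \<open>A point common to two open cells forces the time indices, and the grid coordinates in
  units of \<open>h\<close>, to differ by less than 1; being integers, they agree.\<close>

lemma cell_AE_disjoint:
  assumes "snd i \<in> \<Omega>h" "snd j \<in> \<Omega>h" and \<tau>: "\<tau> > 0"
  shows "AE p in lborel. p \<in> cell \<tau> i \<and> p \<in> cell \<tau> j \<longrightarrow> i = j"
proof -
  obtain n x m y where ij: "i = (n, x)" "j = (m, y)" by (metis surj_pair)
  have same: "x = y \<and> n = m" if "p \<in> box (\<tau> * real n, \<chi> i. x $ i - h / 2) (\<tau> * (real n + 1), \<chi> i. x $ i + h / 2)"
    "p \<in> box (\<tau> * real m, \<chi> i. y $ i - h / 2) (\<tau> * (real m + 1), \<chi> i. y $ i + h / 2)" for p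
  proof -
    obtain t z where p: "p = (t, z)" by (metis surj_pair)
    have "(1, 0) \<in> (Basis :: (real \<times> (real^3)) set)" by (simp add: Basis_prod_def)
    then have t: "\<tau> * real n < t" "t < \<tau> * (real n + 1)" "\<tau> * real m < t" "t < \<tau> * (real m + 1)"
      using that by (force simp: box_def p)+
    have "\<tau> * real n < \<tau> * (real m + 1)" "\<tau> * real m < \<tau> * (real n + 1)" using t by linarith+
    then have nm: "n = m" using \<tau> by simp
    have "x $ k = y $ k" for k
    proof -
      have "(0, axis k 1) \<in> (Basis :: (real \<times> (real^3)) set)"
        by (auto simp: Basis_prod_def Basis_vec_def)
      then have z: "x $ k - h / 2 < z $ k" "z $ k < x $ k + h / 2" "y $ k - h / 2 < z $ k" "z $ k < y $ k + h / 2"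
        using that by (force simp: box_def p inner_axis)+
      obtain a b :: int where ab: "x $ k = h * of_int a" "y $ k = h * of_int b"
        using assms(1,2) unfolding ij disc_def grid_def by fastforce
      have "h * of_int a < h * (of_int b + 1)" "h * of_int b < h * (of_int a + 1)"
        using z by (simp_all add: ab algebra_simps)
      then have "a = b" using h by (simp add: mult_less_cancel_left_pos)
      then show ?thesis by (simp add: ab)
    qed
    then show ?thesis using nm by (simp add: vec_eq_iff)
  qed
  have "AE p in lborel. p \<in> cell \<tau> (k, z) \<longrightarrow>
      p \<in> box (\<tau> * real k, \<chi> i. z $ i - h / 2) (\<tau> * (real k + 1), \<chi> i. z $ i + h / 2)" for k z
    unfolding cell_eq_cbox by (rule AE_cbox_imp_box)
  from this[of n x] this[of m y] have "AE p in lborel. p \<in> cell \<tau> (n, x) \<and> p \<in> cell \<tau> (m, y) \<longrightarrow>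
      p \<in> box (\<tau> * real n, \<chi> i. x $ i - h / 2) (\<tau> * (real n + 1), \<chi> i. x $ i + h / 2) \<and>
      p \<in> box (\<tau> * real m, \<chi> i. y $ i - h / 2) (\<tau> * (real m + 1), \<chi> i. y $ i + h / 2)"
    by eventually_elim auto
  then show ?thesis unfolding ij by eventually_elim (use same in blast)
qed

lemma norm_force_sq_le:
  assumes f: "L2loc \<Omega> f" and x: "x \<in> \<Omega>h" and \<tau>: "\<tau> > 0"
  shows "\<tau> * h^3 * (norm (force h \<tau> f n x))\<^sup>2 \<le> (LINT p:cell \<tau> (n, x)|lborel. (case p of (t, y) \<Rightarrow> (norm (f t y))\<^sup>2))"
proof -
  have sub: "cell \<tau> (n, x) \<subseteq> {0..\<tau> * (real n + 1)} \<times> \<Omega>" using x \<tau> by (intro cell_subset) auto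
  have B: "cell \<tau> (n, x) \<in> sets borel" "bounded (cell \<tau> (n, x))" by (auto simp: cell_eq_cbox)
  note int = L2loc_set_integrable[OF f B(1) sub B(2)] L2loc_set_integrable_sq[OF f B(1) sub]
  have "force h \<tau> f n x = (LINT p:cell \<tau> (n, x)|lborel. (case p of (t, y) \<Rightarrow> f t y)) /\<^sub>R (\<tau> * h^3)"
    using set_integral_Times[of "{\<tau> * real n..\<tau> * (real n + 1)}" "cube h x" "\<lambda>(t, y). f t y"] int(1)
    by (simp add: force_def cell_def)
  moreover have "emeasure lborel (cell \<tau> (n, x)) = ennreal (\<tau> * h^3)"
  proof -
    have "emeasure lborel (cell \<tau> (n, x)) = emeasure (lborel \<Otimes>\<^sub>M lborel) ({\<tau> * real n..\<tau> * (real n + 1)} \<times> cube h x)"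
      by (simp add: cell_def lborel_prod)
    also have "\<dots> = ennreal \<tau> * ennreal (h^3)"
      using \<tau> by (subst lborel.emeasure_pair_measure_Times) (auto simp: emeasure_cube[OF h] sets_cube algebra_simps)
    finally show ?thesis using \<tau> h by (simp add: ennreal_mult)
  qed
  ultimately show ?thesis
    using norm_average_sq_le[of "cell \<tau> (n, x)" lborel "\<tau> * h^3" "\<lambda>(t, y). f t y"] int B \<tau> h
    by (simp add: case_prod_unfold)
qed

text \<open>Averaging over cells does not increase the L2 norm, and the cells of one period are
  almost everywhere disjoint and contained in [0,1] x \<Omega>.\<close>

lemma sum_force_le:
  assumes f: "L2loc \<Omega> f" and opn: "open \<Omega>" and T: "T \<ge> 1" and \<tau>: "\<tau> = 1 / real T"
  shows "\<tau> * (\<Sum>n<T. \<Sum>x\<in>inn. h^3 * (norm (force h \<tau> f n x))\<^sup>2) \<le> (L2norm01 \<Omega> f)\<^sup>2"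
proof -
  define g where "g = (\<lambda>(t, y). (norm (f t y))\<^sup>2)"
  define S where "S = {0..1::real} \<times> \<Omega>"
  define J where "J = {..<T} \<times> inn"
  have \<tau>0: "\<tau> > 0" using T \<tau> by simp
  have sub: "cell \<tau> j \<subseteq> S" if jJ: "j \<in> J" for j
  proof -
    obtain n x where j: "j = (n, x)" "n < T" "x \<in> \<Omega>h" using jJ inner_subset by (cases j) (auto simp: J_def)
    have "\<tau> * (real n + 1) \<le> 1" using j(2) T by (simp add: \<tau> divide_le_eq_1)
    then show ?thesis unfolding S_def j(1) using j(3) \<tau>0 by (intro cell_subset)
  qed
  have cell_sets: "cell \<tau> j \<in> sets borel" for j by (cases j) (simp add: cell_eq_cbox)
  have S: "S \<in> sets borel" unfolding S_def using opn by (intro borel_Times) auto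
  have intS: "set_integrable lborel S g"
    unfolding g_def using S by (intro L2loc_set_integrable_sq[OF f, of _ 1]) (auto simp: S_def)
  have Un: "(\<Union>j\<in>J. cell \<tau> j) \<in> sets borel" using cell_sets finite_inner by (intro sets.finite_UN) (auto simp: J_def)
  have intU: "set_integrable lborel (\<Union>j\<in>J. cell \<tau> j) g"
    using Un sub by (intro set_integrable_subset[OF intS]) auto
  have "\<tau> * (\<Sum>n<T. \<Sum>x\<in>inn. h^3 * (norm (force h \<tau> f n x))\<^sup>2) = (\<Sum>(n, x)\<in>J. \<tau> * h^3 * (norm (force h \<tau> f n x))\<^sup>2)"
    by (simp add: J_def sum.cartesian_product[symmetric] sum_distrib_left mult.assoc)
  also have "\<dots> \<le> (\<Sum>j\<in>J. LINT p:cell \<tau> j|lborel. g p)"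
    unfolding g_def using norm_force_sq_le[OF f _ \<tau>0] inner_subset by (intro sum_mono) (auto simp: J_def)
  also have "\<dots> = (LINT p:(\<Union>j\<in>J. cell \<tau> j)|lborel. g p)"
    using finite_inner cell_sets sub inner_subset
    by (intro set_integral_finite_UN_AE[symmetric] cell_AE_disjoint \<tau>0 set_integrable_subset[OF intS]) (auto simp: J_def)
  also have "\<dots> \<le> (LINT p:S|lborel. g p)"
    using intU intS sub unfolding set_lebesgue_integral_def set_integrable_def
    by (intro integral_mono) (auto simp: indicator_def g_def)
  also have "\<dots> = (L2norm01 \<Omega> f)\<^sup>2"
  proof -
    have "(LINT t:{0..1}|lborel. LINT x:\<Omega>|lborel. (norm (f t x))\<^sup>2) = (LINT p:S|lborel. g p)"
      using set_integral_Times[of "{0..1}" \<Omega> g] intS by (simp add: S_def g_def)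
    moreover have "0 \<le> (LINT p:S|lborel. g p)"
      unfolding set_lebesgue_integral_def by (intro integral_nonneg_AE) (auto simp: g_def)
    ultimately show ?thesis by (simp add: L2norm01_def)
  qed
  finally show ?thesis .
qed

lemma force_periodic:
  assumes f: "L2loc \<Omega> f" and per: "time_periodic1 \<Omega> f" and T: "T \<ge> 1" and \<tau>: "\<tau> = 1 / real T" and x: "x \<in> \<Omega>h"
  shows "force h \<tau> f (n + T) x = force h \<tau> f n x"
proof -
  \<comment> \<open>Measurability is given only on [0, \<infinity>) x \<Omega>; cutting
    \<open>f\<close> off there yields a globally measurable function with the same averages.\<close>
  define g where "g p = indicator ({0..} \<times> \<Omega>) p *\<^sub>R (case p of (t, y) \<Rightarrow> f t y)" for p :: "real \<times> (real^3)"
  have g[measurable]: "g \<in> borel_measurable (lborel \<Otimes>\<^sub>M lborel)"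
    using f unfolding L2loc_def set_borel_measurable_def g_def[abs_def] lborel_prod by simp
  have [measurable]: "cube h x \<in> sets borel" by (simp add: cube_def)
  define G where "G t = (LINT y:cube h x|lborel. g (t, y))" for t
  have G_eq: "(LINT y:cube h x|lborel. f t y) = G t" if "t \<ge> 0" for t
    using cube_subset[OF x] that unfolding G_def by (intro set_lebesgue_integral_cong) (auto simp: g_def)
  have G_meas[measurable]: "G \<in> borel_measurable borel"
    unfolding G_def set_lebesgue_integral_def by measurable
  define I where "I = {\<tau> * real n..\<tau> * (real n + 1)}"
  have \<tau>0: "\<tau> > 0" and \<tau>T: "\<tau> * real T = 1" using T by (auto simp: \<tau>)
  \<comment> \<open>Periodicity holds for almost every \<open>t\<close> and then almost every
    \<open>y\<close>. Integrating over the cube first leaves a function of \<open>t\<close> alone,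
    so the time shift becomes a one-dimensional substitution.\<close>
  have "AE t in lborel. t \<ge> 0 \<longrightarrow> G (1 + t) = G t"
    using per[unfolded time_periodic1_def]
  proof (eventually_elim, intro impI)
    fix t :: real assume *: "t \<ge> 0 \<longrightarrow> (AE x in lborel. x \<in> \<Omega> \<longrightarrow> f (t + 1) x = f t x)" and t: "t \<ge> 0"
    then have "AE y in lborel. y \<in> \<Omega> \<longrightarrow> f (t + 1) y = f t y" by blast
    then have "AE y in lborel. indicator (cube h x) y *\<^sub>R g (1 + t, y) = indicator (cube h x) y *\<^sub>R g (t, y)"
      by eventually_elim (use t in \<open>auto simp: g_def indicator_def add.commute\<close>)
    then show "G (1 + t) = G t"
      unfolding G_def set_lebesgue_integral_def by (intro integral_cong_AE) auto
  qed
  then have AE: "AE t in lborel. indicator I t *\<^sub>R G (1 + t) = indicator I t *\<^sub>R G t"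
    by eventually_elim (use \<tau>0 in \<open>auto simp: I_def indicator_def intro: order_trans[rotated]\<close>)
  have "(LINT t:{\<tau> * real (n + T)..\<tau> * (real (n + T) + 1)}|lborel. LINT y:cube h x|lborel. f t y)
      = (LINT t:{\<tau> * real (n + T)..\<tau> * (real (n + T) + 1)}|lborel. G t)"
    using \<tau>0 by (intro set_lebesgue_integral_cong) (auto intro!: G_eq intro: order_trans[rotated])
  also have "\<dots> = (\<integral>t. indicator {\<tau> * real (n + T)..\<tau> * (real (n + T) + 1)} (1 + t) *\<^sub>R G (1 + t) \<partial>lborel)"
    unfolding set_lebesgue_integral_def by (subst lborel_integral_real_affine[of 1 _ 1]) simp_all
  also have "\<dots> = (\<integral>t. indicator I t *\<^sub>R G (1 + t) \<partial>lborel)"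
    using \<tau>T by (intro Bochner_Integration.integral_cong) (auto simp: I_def indicator_def algebra_simps)
  also have "\<dots> = (\<integral>t. indicator I t *\<^sub>R G t \<partial>lborel)"
    by (intro integral_cong_AE AE) (auto simp: I_def)
  also have "\<dots> = (LINT t:I|lborel. LINT y:cube h x|lborel. f t y)"
    unfolding set_lebesgue_integral_def[of _ I, symmetric] using \<tau>0
    by (intro set_lebesgue_integral_cong) (auto simp: I_def intro!: G_eq[symmetric] intro: order_trans[rotated])
  finally show ?thesis by (simp add: force_def I_def)
qed

end

section \<open>Energy estimate and the time-one map\<close>

context mesh
begin

lemma gnorm_sq:
  assumes "supp_inner v"
  shows "(gnorm \<Omega> h v)\<^sup>2 = h^3 * (\<Sum>x\<in>inn. (norm (v x))\<^sup>2)"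
proof -
  have "(\<Sum>x\<in>\<Omega>h. (norm (v x))\<^sup>2 * h^3) = h^3 * (\<Sum>x\<in>inn. (norm (v x))\<^sup>2)"
    using assms by (subst sum_inner_eq) (auto simp: sum_distrib_left mult.commute)
  then show ?thesis using h by (simp add: gnorm_def sum_nonneg)
qed

text \<open>The scalar inequality summed over components; the right side is enlarged to \<Omega>h to
  match the energy identity.\<close>

lemma poincare_vector:
  assumes P: "\<And>i (\<phi> :: real^3 \<Rightarrow> real). supp_inner \<phi> \<Longrightarrow>
      (\<Sum>x\<in>\<Omega>h. \<bar>\<phi> x\<bar>\<^sup>2) \<le> K * (\<Sum>x\<in>inn. \<bar>Dplus h i \<phi> x\<bar>\<^sup>2)"
    and K: "K > 0" and v: "supp_inner (v :: real^3 \<Rightarrow> real^3)"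
  shows "(\<Sum>x\<in>inn. (norm (v x))\<^sup>2) \<le> K * (\<Sum>x\<in>\<Omega>h. (norm (Dplus h i v x))\<^sup>2)"
proof -
  have norm: "(norm (w :: real^3))\<^sup>2 = (\<Sum>k\<in>UNIV. \<bar>w $ k\<bar>\<^sup>2)" for w
    by (simp add: norm_vec_def L2_set_def sum_nonneg)
  have "(\<Sum>x\<in>inn. (norm (v x))\<^sup>2) = (\<Sum>x\<in>\<Omega>h. (norm (v x))\<^sup>2)"
    using v by (intro sum_inner_eq) auto
  also have "\<dots> = (\<Sum>k\<in>UNIV. \<Sum>x\<in>\<Omega>h. \<bar>v x $ k\<bar>\<^sup>2)"
    unfolding norm by (rule sum.swap)
  also have "\<dots> \<le> (\<Sum>k\<in>UNIV. K * (\<Sum>x\<in>inn. \<bar>Dplus h i (\<lambda>x. v x $ k) x\<bar>\<^sup>2))"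
    using v by (intro sum_mono P) auto
  also have "\<dots> = K * (\<Sum>x\<in>inn. \<Sum>k\<in>UNIV. \<bar>Dplus h i (\<lambda>x. v x $ k) x\<bar>\<^sup>2)"
    unfolding sum_distrib_left[symmetric] by (subst sum.swap) simp
  also have "\<dots> = K * (\<Sum>x\<in>inn. (norm (Dplus h i v x))\<^sup>2)"
    unfolding norm by (simp add: Dplus_def)
  also have "\<dots> \<le> K * (\<Sum>x\<in>\<Omega>h. (norm (Dplus h i v x))\<^sup>2)"
    using K finite_disc inner_subset by (intro mult_left_mono sum_mono2) auto
  finally show ?thesis .
qed

lemma is_step_energy:
  assumes P: "\<And>i (\<phi> :: real^3 \<Rightarrow> real). supp_inner \<phi> \<Longrightarrow>
      (\<Sum>x\<in>\<Omega>h. \<bar>\<phi> x\<bar>\<^sup>2) \<le> K * (\<Sum>x\<in>inn. \<bar>Dplus h i \<phi> x\<bar>\<^sup>2)"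
    and K: "K > 0" and \<tau>: "\<tau> > 0" and b: "b = 3 / K" and step: "is_step \<tau> F v v'"
  shows "(1 + b * \<tau>) * (\<Sum>x\<in>inn. (norm (v' x))\<^sup>2)
    \<le> (\<Sum>x\<in>inn. (norm (v x))\<^sup>2) + \<tau> / b * (\<Sum>x\<in>inn. (norm (F x))\<^sup>2)"
proof -
  define Y where "Y = (\<Sum>x\<in>inn. (norm (v' x))\<^sup>2)"
  define U where "U = (\<Sum>x\<in>inn. (norm (proj v x))\<^sup>2)"
  define G where "G = (\<Sum>x\<in>inn. (norm (F x))\<^sup>2)"
  define C where "C = (\<Sum>x\<in>inn. conv_diff h (proj v) v' x \<bullet> v' x)"
  have v': "supp_inner v'" using step by (simp add: is_step_iff)
  have b0: "b > 0" using K b by simp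
  have "Y / K \<le> (\<Sum>x\<in>\<Omega>h. (norm (Dplus h j v' x))\<^sup>2)" for j
    using poincare_vector[OF P K v', where i = j] K by (simp add: Y_def divide_le_eq mult.commute)
  then have "(\<Sum>j\<in>(UNIV :: 3 set). Y / K) \<le> (\<Sum>j\<in>UNIV. \<Sum>x\<in>\<Omega>h. (norm (Dplus h j v' x))\<^sup>2)"
    by (intro sum_mono)
  moreover have "C = - (\<Sum>j\<in>UNIV. \<Sum>x\<in>\<Omega>h. (norm (Dplus h j v' x))\<^sup>2)"
    unfolding C_def by (rule conv_diff_energy[OF proj_supp proj_div v'])
  \<comment> \<open>Each of the three directions contributes \<open>Y / K\<close>, which is where
    \<open>b = 3 / K\<close> comes from.\<close>
  ultimately have C: "C \<le> - b * Y" by (simp add: b)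
  have "(norm (v' x))\<^sup>2 \<le> (norm (proj v x))\<^sup>2 / 2 + (norm (v' x))\<^sup>2 / 2 + \<tau> * (conv_diff h (proj v) v' x \<bullet> v' x)
      + \<tau> * b / 2 * (norm (v' x))\<^sup>2 + \<tau> / (2 * b) * (norm (F x))\<^sup>2" if "x \<in> inn" for x
  proof -
    have young: "p \<bullet> q \<le> c / 2 * (norm q)\<^sup>2 + 1 / (2 * c) * (norm p)\<^sup>2" if "c > 0" for p q :: "real^3" and c
    proof -
      have "0 \<le> (norm (p - c *\<^sub>R q))\<^sup>2" by simp
      then have "2 * c * (p \<bullet> q) \<le> c\<^sup>2 * (norm q)\<^sup>2 + (norm p)\<^sup>2"
        unfolding power2_norm_eq_inner
        by (simp add: inner_diff_left inner_diff_right inner_commute power2_eq_square algebra_simps)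
      then show ?thesis using that by (simp add: field_simps power2_eq_square)
    qed
    have "(v' x - proj v x) /\<^sub>R \<tau> = conv_diff h (proj v) v' x + F x"
      using step that by (simp add: is_step_iff)
    from arg_cong[OF this, of "scaleR \<tau>"]
    have "v' x = proj v x + \<tau> *\<^sub>R (conv_diff h (proj v) v' x + F x)"
      using \<tau> by (simp add: algebra_simps)
    then have "(norm (v' x))\<^sup>2 = proj v x \<bullet> v' x + \<tau> * (conv_diff h (proj v) v' x \<bullet> v' x) + \<tau> * (F x \<bullet> v' x)"
      unfolding power2_norm_eq_inner by (metis add.assoc distrib_left inner_add_left inner_scaleR_left)
    moreover have "proj v x \<bullet> v' x \<le> (norm (proj v x))\<^sup>2 / 2 + (norm (v' x))\<^sup>2 / 2"
      using young[of 1 "proj v x" "v' x"] by simp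
    \<comment> \<open>The weight \<open>b\<close> spends half of the dissipation on the force. After
      doubling, exactly \<open>b * \<tau>\<close> remains on the left.\<close>
    moreover have "\<tau> * (F x \<bullet> v' x) \<le> \<tau> * (b / 2 * (norm (v' x))\<^sup>2 + 1 / (2 * b) * (norm (F x))\<^sup>2)"
      using young[OF b0, of "F x" "v' x"] \<tau> by (intro mult_left_mono) auto
    ultimately show ?thesis by (simp add: distrib_left)
  qed
  then have "Y \<le> (\<Sum>x\<in>inn. (norm (proj v x))\<^sup>2 / 2 + (norm (v' x))\<^sup>2 / 2 + \<tau> * (conv_diff h (proj v) v' x \<bullet> v' x)
      + \<tau> * b / 2 * (norm (v' x))\<^sup>2 + \<tau> / (2 * b) * (norm (F x))\<^sup>2)"
    unfolding Y_def by (rule sum_mono)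
  also have "\<dots> = U / 2 + Y / 2 + \<tau> * C + \<tau> * b / 2 * Y + \<tau> / (2 * b) * G"
    unfolding U_def Y_def C_def G_def
    by (simp only: sum.distrib sum_divide_distrib[symmetric] sum_distrib_left[symmetric])
  also have "\<tau> * C \<le> \<tau> * (- b * Y)" using C \<tau> by (intro mult_left_mono) auto
  finally have "(1 + b * \<tau>) * Y \<le> U + \<tau> / b * G"
    by (simp add: field_simps)
  moreover have "U \<le> (\<Sum>x\<in>inn. (norm (v x))\<^sup>2)" unfolding U_def by (rule proj_norm_le)
  ultimately show ?thesis by (simp add: Y_def G_def)
qed

text \<open>The iteration as a total function of the initial field. The choice is harmless since a
  step exists and is unique for \<tau> > 0.\<close>

primrec traj :: "real \<Rightarrow> (real \<Rightarrow> real^3 \<Rightarrow> real^3) \<Rightarrow> (real^3 \<Rightarrow> real^3) \<Rightarrow> nat \<Rightarrow> real^3 \<Rightarrow> real^3" where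
  "traj \<tau> f v 0 = v"
| "traj \<tau> f v (Suc n) = (SOME v'. is_step \<tau> (force h \<tau> f n) (traj \<tau> f v n) v')"

lemma is_step_traj: "\<tau> > 0 \<Longrightarrow> is_step \<tau> (force h \<tau> f n) (traj \<tau> f v n) (traj \<tau> f v (Suc n))"
  by (simp add: someI_ex[OF is_step_exists])

lemma traj_supp: "\<tau> > 0 \<Longrightarrow> supp_inner v \<Longrightarrow> supp_inner (traj \<tau> f v n)"
  using is_step_traj[of \<tau> f _ v] by (cases n) (auto simp: is_step_iff simp del: traj.simps(2))

lemma ns_solution_traj:
  assumes "\<tau> > 0" "supp_inner v"
  shows "ns_solution \<Omega> h \<tau> f (\<lambda>n. proj (traj \<tau> f v n)) (traj \<tau> f v)"
proof -
  have "traj \<tau> f v n \<in> gridfun \<Omega> h" for n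
    using traj_supp[OF assms] supp_inner_iff by blast
  then show ?thesis
    using is_step_traj[OF assms(1)] by (auto simp: ns_solution_def is_step_def simp del: traj.simps(2))
qed

lemma ns_solution_unique:
  assumes "\<tau> > 0" "ns_solution \<Omega> h \<tau> f u ut"
  shows "ut = traj \<tau> f (ut 0)"
proof
  fix n
  show "ut n = traj \<tau> f (ut 0) n"
  proof (induction n)
    case (Suc n)
    have "is_step \<tau> (force h \<tau> f n) (ut n) (ut (Suc n))"
      using assms(2) unfolding ns_solution_def is_step_def by metis
    then show ?case
      using is_step_unique[OF assms(1)] is_step_traj[OF assms(1)] Suc by metis
  qed simp
qed

lemma time_one_map_eq:
  assumes T: "T \<ge> 1" and v: "supp_inner v"
  shows "time_one_map \<Omega> h T f v = traj (1 / real T) f v T"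
  unfolding time_one_map_def
proof (rule the_equality)
  have \<tau>: "1 / real T > 0" using T by simp
  show "\<exists>u ut. ns_solution \<Omega> h (1 / real T) f u ut \<and> ut 0 = v \<and> ut T = traj (1 / real T) f v T"
    using ns_solution_traj[OF \<tau> v, of f] traj.simps(1) by blast
  fix w assume "\<exists>u ut. ns_solution \<Omega> h (1 / real T) f u ut \<and> ut 0 = v \<and> ut T = w"
  then show "w = traj (1 / real T) f v T"
    using ns_solution_unique[OF \<tau>] by metis
qed

lemma traj_tendsto:
  assumes "\<tau> > 0" "\<And>y. (\<lambda>m. V m y) \<longlonglongrightarrow> v y"
  shows "(\<lambda>m. traj \<tau> f (V m) n x) \<longlonglongrightarrow> traj \<tau> f v n x"
proof (induction n arbitrary: x)
  case 0
  then show ?case using assms(2) by simp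
next
  case (Suc n)
  show ?case by (rule is_step_tendsto[OF assms(1) Suc is_step_traj[OF assms(1)] is_step_traj[OF assms(1)]])
qed

lemma traj_energy:
  assumes P: "\<And>i (\<phi> :: real^3 \<Rightarrow> real). supp_inner \<phi> \<Longrightarrow>
      (\<Sum>x\<in>\<Omega>h. \<bar>\<phi> x\<bar>\<^sup>2) \<le> K * (\<Sum>x\<in>inn. \<bar>Dplus h i \<phi> x\<bar>\<^sup>2)"
    and K: "K > 0" and \<tau>: "\<tau> > 0" and b: "b = 3 / K"
  shows "(\<Sum>x\<in>inn. (norm (traj \<tau> f v n x))\<^sup>2)
    \<le> (\<Sum>x\<in>inn. (norm (v x))\<^sup>2) / (1 + b * \<tau>) ^ n + \<tau> / b * (\<Sum>k<n. \<Sum>x\<in>inn. (norm (force h \<tau> f k x))\<^sup>2)"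
proof (induction n)
  case 0
  then show ?case by simp
next
  case (Suc n)
  define r where "r = 1 + b * \<tau>"
  have b0: "b > 0" using K b by simp
  have r: "r \<ge> 1" using b0 \<tau> by (simp add: r_def)
  define G where "G k = (\<Sum>x\<in>inn. (norm (force h \<tau> f k x))\<^sup>2)" for k
  have "0 \<le> \<tau> / b * sum G {..<Suc n}" using b0 \<tau> by (simp add: G_def sum_nonneg)
  \<comment> \<open>The decay of earlier force terms is given up: the undamped sum suffices and
    keeps the bound independent of the number of steps.\<close>
  then have le: "\<tau> / b * sum G {..<Suc n} \<le> r * (\<tau> / b * sum G {..<Suc n})"
    using mult_right_mono[OF r] by fastforce
  have "r * (\<Sum>x\<in>inn. (norm (traj \<tau> f v (Suc n) x))\<^sup>2)
      \<le> (\<Sum>x\<in>inn. (norm (traj \<tau> f v n x))\<^sup>2) + \<tau> / b * G n"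
    unfolding r_def G_def by (rule is_step_energy[OF P K \<tau> b is_step_traj[OF \<tau>]])
  also have "\<dots> \<le> (\<Sum>x\<in>inn. (norm (v x))\<^sup>2) / r ^ n + \<tau> / b * sum G {..<n} + \<tau> / b * G n"
    using Suc by (simp add: r_def G_def)
  also have "\<dots> = (\<Sum>x\<in>inn. (norm (v x))\<^sup>2) / r ^ n + \<tau> / b * sum G {..<Suc n}"
    by (simp add: distrib_left)
  also have "\<dots> \<le> (\<Sum>x\<in>inn. (norm (v x))\<^sup>2) / r ^ n + r * (\<tau> / b * sum G {..<Suc n})" using le by (rule add_left_mono)
  also have "\<dots> = r * ((\<Sum>x\<in>inn. (norm (v x))\<^sup>2) / r ^ Suc n + \<tau> / b * sum G {..<Suc n})"
    using r by (simp add: distrib_left)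
  finally show ?case using r unfolding r_def[symmetric] G_def by (simp add: mult_le_cancel_left)
qed

end

section \<open>Arithmetic of the threshold radius\<close>

lemma R0_nonneg: "0 \<le> R0 A \<Omega> f"
proof -
  have "0 \<le> (LINT x:\<Omega>|lborel. (norm (f t x))\<^sup>2)" for t
    unfolding set_lebesgue_integral_def by (rule Bochner_Integration.integral_nonneg) simp
  then have "0 \<le> (LINT t:{0..1}|lborel. LINT x:\<Omega>|lborel. (norm (f t x))\<^sup>2)"
    unfolding set_lebesgue_integral_def[of lborel "{0..1}"] by (intro Bochner_Integration.integral_nonneg) simp
  then have "0 \<le> L2norm01 \<Omega> f" unfolding L2norm01_def by (rule real_sqrt_ge_zero)
  then show ?thesis by (simp add: R0_def Let_def)
qed

text \<open>
  Only \<open>1 - exp (- a) \<le> a\<close> and \<open>1 - exp (- a) \<le> 1\<close> enter here: the factor \<open>1 / (1 + 3 * a)\<close> is Bernoulli's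
  bound for the decay over one period, with three times the Poincare rate because all three
  directions contribute.
\<close>

lemma R0_sq_bound:
  fixes A :: "real \<Rightarrow> real"
  assumes A: "A (diameter \<Omega>) > 0" and R: "R \<ge> R0 A \<Omega> f" and a: "a = 1 / (A (diameter \<Omega>))\<^sup>2"
  shows "R\<^sup>2 / (1 + 3 * a) + (L2norm01 \<Omega> f)\<^sup>2 / (3 * a) \<le> R\<^sup>2"
proof -
  define E where "E = exp (- a)"
  define G where "G = (L2norm01 \<Omega> f)\<^sup>2"
  have a0: "a > 0" using A by (simp add: a)
  have E: "0 < E" "E < 1" "1 - E \<le> a" using a0 exp_ge_add_one_self[of "- a"] by (auto simp: E_def)
  have E2: "exp (- 2 * a) = E\<^sup>2" by (simp add: E_def power2_eq_square flip: exp_add)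
  have G0: "0 \<le> G" by (simp add: G_def)
  have E21: "E\<^sup>2 \<le> 1" using E by (simp add: power_le_one)
  have R0: "R0 A \<Omega> f = 1 / (1 - E) * sqrt ((1 - E\<^sup>2) / (2 * a)) * L2norm01 \<Omega> f"
    unfolding R0_def Let_def a[symmetric] E2 E_def[symmetric] ..
  have le_R: "(R0 A \<Omega> f)\<^sup>2 \<le> R\<^sup>2" using R R0_nonneg by (rule power_mono)
  have "(R0 A \<Omega> f)\<^sup>2 = (1 - E\<^sup>2) / (2 * a) / (1 - E)\<^sup>2 * G"
    unfolding R0 G_def power_mult_distrib power_divide using E21 a0 by simp
  also have "(1 - E\<^sup>2) / (2 * a) / (1 - E)\<^sup>2 = (1 + E) / (2 * a * (1 - E))"
    using E a0 by (simp add: divide_simps power2_eq_square) (simp add: algebra_simps)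
  finally have R0_sq: "(R0 A \<Omega> f)\<^sup>2 = (1 + E) / (2 * a * (1 - E)) * G" .
  \<comment> \<open>Solving the claim for R^2 gives the threshold
    \<open>(1 + 3 * a) / (9 * a\<^sup>2) * G\<close>, so it suffices that the square of
    \<open>R0\<close> exceeds it.\<close>
  have "(1 + 3 * a) / (9 * a\<^sup>2) * G \<le> (1 + E) / (2 * a * (1 - E)) * G"
  proof (rule mult_right_mono[OF _ G0])
    show "(1 + 3 * a) / (9 * a\<^sup>2) \<le> (1 + E) / (2 * a * (1 - E))"
    proof -
      have le: "a * (1 - E) \<le> a * 1" using E a0 by (intro mult_left_mono) auto
      have "(1 + 3 * a) * (2 * (1 - E)) = 2 * (1 - E) + 6 * (a * (1 - E))" by (simp add: algebra_simps)
      also have "\<dots> \<le> 2 * a + 6 * (a * 1)" using E le by (intro add_mono mult_left_mono) auto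
      also have "\<dots> \<le> 9 * a * 1" using a0 by simp
      also have "\<dots> \<le> 9 * a * (1 + E)" using E a0 by (intro mult_left_mono) auto
      finally have "1 + 3 * a \<le> 9 * a * (1 + E) / (2 * (1 - E))" using E by (simp add: pos_le_divide_eq)
      also have "\<dots> = (1 + E) / (2 * a * (1 - E)) * (9 * a\<^sup>2)" using a0 by (simp add: power2_eq_square)
      finally show ?thesis using a0 by (simp add: pos_divide_le_eq)
    qed
  qed
  with le_R have "(1 + 3 * a) / (9 * a\<^sup>2) * G \<le> R\<^sup>2" unfolding R0_sq by (rule order_trans[rotated])
  then have "G * (1 + 3 * a) \<le> R\<^sup>2 * (9 * a\<^sup>2)" using a0 by (simp add: field_simps)
  then have "R\<^sup>2 * (3 * a) + G * (1 + 3 * a) \<le> R\<^sup>2 * ((1 + 3 * a) * (3 * a))"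
    by (simp add: algebra_simps power2_eq_square)
  moreover have "R\<^sup>2 / (1 + 3 * a) + G / (3 * a) = (R\<^sup>2 * (3 * a) + G * (1 + 3 * a)) / ((1 + 3 * a) * (3 * a))"
    using a0 by (intro add_frac_eq) auto
  moreover have "(1 + 3 * a) * (3 * a) > 0" using a0 by simp
  ultimately show ?thesis unfolding G_def[symmetric] by (metis pos_divide_le_eq)
qed

section \<open>Invariance of the ball and periodicity of the orbit\<close>

lemma (in mesh) U_ball_iff: "v \<in> U_ball \<Omega> h R \<longleftrightarrow> supp_inner v \<and> gnorm \<Omega> h v \<le> R"
  unfolding U_ball_def using supp_inner_iff[of v] by blast

lemma diameter_pos:
  fixes \<Omega> :: "(real^3) set"
  assumes "open \<Omega>" "bounded \<Omega>" "\<Omega> \<noteq> {}"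
  shows "diameter \<Omega> > 0"
proof -
  obtain x r where r: "r > 0" "cball x r \<subseteq> \<Omega>" using assms open_contains_cball by blast
  have "0 < dist x (x + r *\<^sub>R e 1)" using r by (simp add: dist_norm)
  also have "\<dots> \<le> diameter \<Omega>"
    using r by (intro diameter_bounded_bound assms) (auto simp: subset_iff dist_norm)
  finally show ?thesis .
qed

lemma (in mesh) traj_in_U_ball:
  assumes A: "poincare_constant A" and \<Omega>: "lipschitz_domain \<Omega>" and f: "L2loc \<Omega> f"
    and adm: "admissible_mesh \<Omega> h" and T: "T \<ge> 1" and R: "R \<ge> R0 A \<Omega> f" and v: "v \<in> U_ball \<Omega> h R"
  shows "traj (1 / real T) f v T \<in> U_ball \<Omega> h R"
proof -
  define \<tau> where "\<tau> = 1 / real T"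
  have \<tau>: "\<tau> > 0" and T\<tau>: "real T * \<tau> = 1" using T by (auto simp: \<tau>_def)
  define w where "w = traj \<tau> f v T"
  have supp: "supp_inner v" "supp_inner w"
    using v traj_supp[OF \<tau>] by (simp_all add: w_def U_ball_iff)
  have opn: "open \<Omega>" using \<Omega> by (simp add: lipschitz_domain_def)
  have "gnorm \<Omega> h w \<le> R"
  \<comment> \<open>The empty set passes as a domain, but its diameter is 0, where nothing is known
    about the sign of \<open>A\<close>; the grid is then empty and all norms agree.\<close>
  proof (cases "\<Omega> = {}")
    case True
    then have "gnorm \<Omega> h w = gnorm \<Omega> h v" by (simp add: gnorm_def disc_def)
    then show ?thesis using v by (simp add: U_ball_iff)
  next
    case False
    define K where "K = (A (diameter \<Omega>))\<^sup>2"
    have A0: "A (diameter \<Omega>) > 0"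
      using A diameter_pos[OF opn bounded False] by (simp add: poincare_constant_def)
    then have K: "K > 0" by (simp add: K_def)
    define b where "b = 3 / K"
    have b0: "b > 0" using K by (simp add: b_def)
    have P: "(\<Sum>x\<in>\<Omega>h. \<bar>\<phi> x\<bar>\<^sup>2) \<le> K * (\<Sum>x\<in>inn. \<bar>Dplus h i \<phi> x\<bar>\<^sup>2)" if "supp_inner \<phi>" for i and \<phi> :: "real^3 \<Rightarrow> real"
    proof -
      have "\<phi> \<in> gridfun \<Omega> h" "\<forall>x\<in>bdry \<Omega> h. \<phi> x = 0" using that supp_inner_iff[of \<phi>] by blast+
      then show ?thesis
        unfolding K_def using A[unfolded poincare_constant_def, THEN conjunct2, rule_format, OF \<Omega> adm, of \<phi> i] by simp
    qed
    define S where "S = (\<Sum>k<T. \<Sum>x\<in>inn. (norm (force h \<tau> f k x))\<^sup>2)"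
    have "(\<Sum>x\<in>inn. (norm (w x))\<^sup>2) \<le> (\<Sum>x\<in>inn. (norm (v x))\<^sup>2) / (1 + b * \<tau>) ^ T + \<tau> / b * S"
      unfolding w_def S_def by (rule traj_energy[OF P K \<tau> b_def])
    also have "\<dots> \<le> (\<Sum>x\<in>inn. (norm (v x))\<^sup>2) / (1 + b) + \<tau> / b * S"
    proof -
      \<comment> \<open>Bernoulli's inequality makes the decay over a period independent of the
        number of steps, because \<open>T\<close> times \<tau> is 1.\<close>
      have "1 + real T * (b * \<tau>) \<le> (1 + b * \<tau>) ^ T"
        using mult_pos_pos[OF b0 \<tau>] by (intro Bernoulli_inequality) linarith
      then have "1 + b \<le> (1 + b * \<tau>) ^ T" using T\<tau> by (simp add: mult.left_commute)
      then show ?thesis using b0 by (intro add_right_mono divide_left_mono) (auto intro!: sum_nonneg mult_pos_pos)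
    qed
    finally have "h^3 * (\<Sum>x\<in>inn. (norm (w x))\<^sup>2)
        \<le> h^3 * ((\<Sum>x\<in>inn. (norm (v x))\<^sup>2) / (1 + b) + \<tau> / b * S)"
      using h by (intro mult_left_mono) auto
    also have "\<dots> = (gnorm \<Omega> h v)\<^sup>2 / (1 + b) + (\<tau> * (h^3 * S)) / b"
      by (simp add: gnorm_sq[OF supp(1)] distrib_left)
    also have "\<dots> \<le> R\<^sup>2 / (1 + b) + (L2norm01 \<Omega> f)\<^sup>2 / b"
    proof (rule add_mono)
      have "0 \<le> gnorm \<Omega> h v" using h by (simp add: gnorm_def sum_nonneg)
      then have "(gnorm \<Omega> h v)\<^sup>2 \<le> R\<^sup>2" using v by (intro power_mono) (simp_all add: U_ball_iff)
      then show "(gnorm \<Omega> h v)\<^sup>2 / (1 + b) \<le> R\<^sup>2 / (1 + b)" using b0 by (intro divide_right_mono) simp_all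
      have "h^3 * S = (\<Sum>k<T. \<Sum>x\<in>inn. h^3 * (norm (force h \<tau> f k x))\<^sup>2)"
        by (simp add: S_def sum_distrib_left)
      then have "\<tau> * (h^3 * S) \<le> (L2norm01 \<Omega> f)\<^sup>2" using sum_force_le[OF f opn T \<tau>_def] by simp
      then show "\<tau> * (h^3 * S) / b \<le> (L2norm01 \<Omega> f)\<^sup>2 / b" using b0 by (intro divide_right_mono) simp_all
    qed
    also have "\<dots> \<le> R\<^sup>2"
      using R0_sq_bound[OF A0 R refl] by (simp add: b_def K_def)
    finally have "(gnorm \<Omega> h w)\<^sup>2 \<le> R\<^sup>2" by (simp add: gnorm_sq[OF supp(2)])
    moreover have "0 \<le> R" using R R0_nonneg[of A \<Omega> f] by linarith
    ultimately show ?thesis by (rule power2_le_imp_le)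
  qed
  then show ?thesis using supp by (simp add: U_ball_iff w_def \<tau>_def)
qed

text \<open>The force enters a step only at inner points, where it repeats after \<open>T\<close>
  steps; uniqueness of the step then propagates the coincidence of the fields at times 0 and
  \<open>T\<close>.\<close>

lemma (in mesh) traj_periodic:
  assumes f: "L2loc \<Omega> f" "time_periodic1 \<Omega> f" and T: "T \<ge> 1" and \<tau>: "\<tau> = 1 / real T"
    and v: "traj \<tau> f v T = v"
  shows "traj \<tau> f v (n + T) = traj \<tau> f v n"
proof (induction n)
  case 0
  then show ?case using v by simp
next
  case (Suc n)
  have \<tau>0: "\<tau> > 0" using T \<tau> by simp
  have "force h \<tau> f (n + T) x = force h \<tau> f n x" if "x \<in> inn" for x
    using that inner_subset by (intro force_periodic f T \<tau>) auto
  then have "is_step \<tau> (force h \<tau> f n) (traj \<tau> f v n) (traj \<tau> f v (Suc (n + T)))"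
    using is_step_traj[OF \<tau>0, of f "n + T" v] unfolding is_step_iff Suc by simp
  from is_step_unique[OF \<tau>0 this is_step_traj[OF \<tau>0]] show ?case by simp
qed

theorem theorem4p2:
  fixes A :: "real \<Rightarrow> real" and \<Omega> :: "(real^3) set"
    and f :: "real \<Rightarrow> real^3 \<Rightarrow> real^3" and h R :: real and T1 :: nat
  assumes "poincare_constant A"
    and "lipschitz_domain \<Omega>"
    and "L2loc \<Omega> f" and "time_periodic1 \<Omega> f"
    and "admissible_mesh \<Omega> h"
    and "T1 \<ge> 1"
    and "R \<ge> R0 A \<Omega> f"
  shows "time_one_map \<Omega> h T1 f \<in> U_ball \<Omega> h R \<rightarrow> U_ball \<Omega> h R \<and>
    (\<exists>v\<in>U_ball \<Omega> h R. time_one_map \<Omega> h T1 f v = v \<and>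
       (\<exists>u ut. ns_solution \<Omega> h (1 / real T1) f u ut \<and> ut 0 = v \<and>
          (\<forall>n. u (n + T1) = u n \<and> ut (n + T1) = ut n)))"
proof -
  interpret mesh \<Omega> h
    using assms by unfold_locales (auto simp: lipschitz_domain_def admissible_mesh_def)
  define \<tau> where "\<tau> = 1 / real T1"
  have \<tau>: "\<tau> > 0" using assms(6) by (simp add: \<tau>_def)
  have R: "R \<ge> 0" using assms(7) R0_nonneg[of A \<Omega> f] by linarith
  define \<Phi> where "\<Phi> v = traj \<tau> f v T1" for v
  have map_eq: "time_one_map \<Omega> h T1 f v = \<Phi> v" if "v \<in> U_ball \<Omega> h R" for v
    using that time_one_map_eq[OF assms(6)] by (simp add: \<Phi>_def \<tau>_def U_ball_iff)
  have self: "\<Phi> v \<in> U_ball \<Omega> h R" if "v \<in> U_ball \<Omega> h R" for v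
    unfolding \<Phi>_def \<tau>_def by (rule traj_in_U_ball[OF assms(1-3,5-7) that])
  \<comment> \<open>The grid norm carries the weight h^3 while the Brouwer lemma uses a plain sum of
    squares, hence this rescaled radius.\<close>
  define r where "r = R / sqrt (h^3)"
  have r: "r \<ge> 0" "r\<^sup>2 = R\<^sup>2 / h^3" using R h by (simp_all add: r_def power_divide)
  have ball_eq: "U_ball \<Omega> h R = {v. (\<forall>x. x \<notin> inn \<longrightarrow> v x = 0) \<and> (\<Sum>x\<in>inn. (norm (v x))\<^sup>2) \<le> r\<^sup>2}"
  proof -
    have "gnorm \<Omega> h v \<le> R \<longleftrightarrow> (\<Sum>x\<in>inn. (norm (v x))\<^sup>2) \<le> r\<^sup>2" if "supp_inner v" for v
    proof -
      have "gnorm \<Omega> h v \<le> R \<longleftrightarrow> (gnorm \<Omega> h v)\<^sup>2 \<le> R\<^sup>2"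
        using R h by (intro power_mono_iff[symmetric]) (auto simp: gnorm_def sum_nonneg)
      then show ?thesis using h by (simp add: gnorm_sq[OF that] r(2) le_divide_eq mult.commute)
    qed
    then show ?thesis by (auto simp: U_ball_iff)
  qed
  have "\<exists>v\<in>{v. (\<forall>x. x \<notin> inn \<longrightarrow> v x = 0) \<and> (\<Sum>x\<in>inn. (norm (v x))\<^sup>2) \<le> r\<^sup>2}. \<Phi> v = v"
  proof (rule brouwer_ball_finite_support[OF finite_inner r(1)])
    show "(\<lambda>m. \<Phi> (U m) x) \<longlonglongrightarrow> \<Phi> u x" if "\<And>y. (\<lambda>m. U m y) \<longlonglongrightarrow> u y" for U u x
      unfolding \<Phi>_def by (rule traj_tendsto[OF \<tau> that])
  qed (use self in \<open>simp only: ball_eq\<close>)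
  then obtain v where v: "v \<in> U_ball \<Omega> h R" "\<Phi> v = v" unfolding ball_eq by blast
  have "traj \<tau> f v (n + T1) = traj \<tau> f v n" for n
    using v(2) by (intro traj_periodic assms(3,4,6) \<tau>_def) (simp add: \<Phi>_def)
  moreover have "ns_solution \<Omega> h \<tau> f (\<lambda>n. proj (traj \<tau> f v n)) (traj \<tau> f v)"
    using v(1) by (intro ns_solution_traj \<tau>) (simp add: U_ball_iff)
  ultimately have sol: "\<exists>u ut. ns_solution \<Omega> h \<tau> f u ut \<and> ut 0 = v \<and> (\<forall>n. u (n + T1) = u n \<and> ut (n + T1) = ut n)"
    by (intro exI[of _ "\<lambda>n. proj (traj \<tau> f v n)"] exI[of _ "traj \<tau> f v"]) simp
  have "time_one_map \<Omega> h T1 f v = v" using map_eq[OF v(1)] v(2) by simp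
  moreover have "time_one_map \<Omega> h T1 f \<in> U_ball \<Omega> h R \<rightarrow> U_ball \<Omega> h R"
    using map_eq self by (intro Pi_I) simp
  ultimately show ?thesis using v(1) sol[unfolded \<tau>_def] by blast
qed

end
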